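(* There exist a quadratic polynomial $u$ on $\mathbb{R}^6$ (that is, a real polynomial of degree exactly $2$; in particular $u$ is not affine) and a uniformly elliptic integrand $\Phi \in C^{2,1}(\mathbb{S}^6)$ such that $u$ is $\Phi$-minimal on $\mathbb{R}^6$.
   Context: An integrand on $\mathbb{S}^n \subset \mathbb{R}^{n+1}$ is a positive even function $\Phi$ on $\mathbb{S}^n$ of class at least $C^{2,\alpha}$ for some $\alpha\in(0,1]$. It is identified with its one-homogeneous extension to $\mathbb{R}^{n+1}$, i.e. $\Phi(t\nu) = t\,\Phi(\nu)$ for $t \ge 0$, $\nu \in \mathbb{S}^n$. The integrand $\Phi$ is uniformly elliptic if this one-homogeneous extension has uniformly convex level sets, i.e. the hypersurface $\{\Phi = 1\}$ has all principal curvatures bounded below by a positive constant (equivalently, there is $\lambda > 0$ with $D^2\Phi(\nu)(\xi,\xi) \ge \lambda|\xi|^2$ for all $\nu \in \mathbb{S}^n$ and $\xi \perp \nu$). For an oriented hypersurface $\Sigma \subset \mathbb{R}^{n+1}$ with unit normal $\nu$, set $A_\Phi(\Sigma) = \int_\Sigma \Phi(\nu)$. If $\Sigma$ is the graph of a smooth function $u$ on a domain $\Omega \subset \mathbb{R}^n$, then $A_\Phi(\Sigma) = \int_\Omega \varphi(\nabla u)\,dx$ with $\varphi(p) := \Phi(-p,1)$, $p \in \mathbb{R}^n$. The function $u$ is called $\Phi$-minimal on $\Omega$ if its graph is a critical point of $A_\Phi$, i.e. $u$ solves the Euler-Lagrange equation $$\operatorname{div}(\nabla\varphi(\nabla u))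 = \sum_{i,j=1}^n \varphi_{ij}(\nabla u)\,u_{ij} = 0 \quad \text{in } \Omega.$$ *)

theory Defs
  imports "HOL-Analysis.Analysis"
begin

text \<open>
  \<open>\<real>\<^sup>n\<^sup>+\<^sup>1\<close> is modelled as the Euclidean space \<open>\<real>\<^sup>n \<times> \<real>\<close>, the last coordinate being the
  vertical direction of graphs. A function on the unit sphere is represented by a function
  on the ambient space of which only the values on the sphere are used.
\<close>

section \<open>Derivatives and regularity classes\<close>

definition pderiv_dir :: "'a::euclidean_space \<Rightarrow> ('a \<Rightarrow> real) \<Rightarrow> 'a \<Rightarrow> real" where
  "pderiv_dir b f x = frechet_derivative f (at x) b"

definition gradient :: "('a::euclidean_space \<Rightarrow> real) \<Rightarrow> 'a \<Rightarrow> 'a" where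
  "gradient f x = (\<Sum>b\<in>Basis. pderiv_dir b f x *\<^sub>R b)"

definition divergence :: "('a::euclidean_space \<Rightarrow> 'a) \<Rightarrow> 'a \<Rightarrow> real" where
  "divergence F x = (\<Sum>b\<in>Basis. pderiv_dir b (\<lambda>y. F y \<bullet> b) x)"

text \<open>The following classes are only meant for open \<open>U\<close>.\<close>

primrec Ck_on :: "nat \<Rightarrow> 'a::euclidean_space set \<Rightarrow> ('a \<Rightarrow> real) \<Rightarrow> bool" where
  "Ck_on 0 U f \<longleftrightarrow> continuous_on U f"
| "Ck_on (Suc k) U f \<longleftrightarrow>
     (\<forall>x\<in>U. f differentiable at x) \<and> (\<forall>b\<in>Basis. Ck_on k U (pderiv_dir b f))"

definition smooth_on :: "'a::euclidean_space set \<Rightarrow> ('a \<Rightarrow> real) \<Rightarrow> bool" where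
  "smooth_on U f \<longleftrightarrow> (\<forall>k. Ck_on k U f)"

definition holder_on :: "real \<Rightarrow> 'a::metric_space set \<Rightarrow> ('a \<Rightarrow> real) \<Rightarrow> bool" where
  "holder_on \<alpha> U f \<longleftrightarrow> (\<exists>C. \<forall>x\<in>U. \<forall>y\<in>U. \<bar>f x - f y\<bar> \<le> C * dist x y powr \<alpha>)"

definition C2_holder_on :: "real \<Rightarrow> 'a::euclidean_space set \<Rightarrow> ('a \<Rightarrow> real) \<Rightarrow> bool" where
  "C2_holder_on \<alpha> U f \<longleftrightarrow>
     Ck_on 2 U f \<and> (\<forall>b\<in>Basis. \<forall>c\<in>Basis. holder_on \<alpha> U (pderiv_dir c (pderiv_dir b f)))"

text \<open>
  \<open>C\<^sup>2\<^sup>,\<^sup>\<alpha>\<close> regularity on the sphere, as for any compact smooth submanifold: being the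
  restriction of a \<open>C\<^sup>2\<^sup>,\<^sup>\<alpha>\<close> function defined on a neighbourhood.
\<close>

definition C2_holder_sphere :: "real \<Rightarrow> ('a::euclidean_space \<Rightarrow> real) \<Rightarrow> bool" where
  "C2_holder_sphere \<alpha> \<Phi> \<longleftrightarrow>
     (\<exists>U g. open U \<and> sphere 0 1 \<subseteq> U \<and> C2_holder_on \<alpha> U g \<and> (\<forall>\<nu>\<in>sphere 0 1. g \<nu> = \<Phi> \<nu>))"

section \<open>Integrands\<close>

definition integrand :: "('a::euclidean_space \<Rightarrow> real) \<Rightarrow> bool" where
  "integrand \<Phi> \<longleftrightarrow>
     (\<forall>\<nu>\<in>sphere 0 1. 0 < \<Phi> \<nu>) \<and> (\<forall>\<nu>\<in>sphere 0 1. \<Phi> (- \<nu>) = \<Phi> \<nu>) \<and>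
     (\<exists>\<alpha>. 0 < \<alpha> \<and> \<alpha> \<le> 1 \<and> C2_holder_sphere \<alpha> \<Phi>)"

text \<open>The one-homogeneous extension; recall that \<open>sgn x = x /\<^sub>R norm x\<close>.\<close>

definition hom_ext :: "('a::euclidean_space \<Rightarrow> real) \<Rightarrow> 'a \<Rightarrow> real" where
  "hom_ext \<Phi> x = norm x * \<Phi> (sgn x)"

text \<open>
  The principal curvatures at \<open>x\<close> of the level set of \<open>F\<close> through \<open>x\<close> are the eigenvalues of
  the differential of the Gauss map \<open>\<nabla>F / |\<nabla>F|\<close> on the tangent space \<open>(\<nabla>F x)\<^sup>\<bottom>\<close>. When
  \<open>{F \<le> 1}\<close> is a convex body, this is the outward normal and they are nonnegative on \<open>{F = 1}\<close>.
\<close>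

definition principal_curvature :: "('a::euclidean_space \<Rightarrow> real) \<Rightarrow> 'a \<Rightarrow> real \<Rightarrow> bool" where
  "principal_curvature F x \<kappa> \<longleftrightarrow>
     (\<exists>\<xi>. \<xi> \<noteq> 0 \<and> \<xi> \<bullet> gradient F x = 0 \<and>
          frechet_derivative (\<lambda>y. sgn (gradient F y)) (at x) \<xi> = \<kappa> *\<^sub>R \<xi>)"

definition uniformly_elliptic :: "('a::euclidean_space \<Rightarrow> real) \<Rightarrow> bool" where
  "uniformly_elliptic \<Phi> \<longleftrightarrow>
     (\<exists>c>0. \<forall>x \<kappa>. hom_ext \<Phi> x = 1 \<longrightarrow> principal_curvature (hom_ext \<Phi>) x \<kappa> \<longrightarrow> c \<le> \<kappa>)"

section \<open>Minimal graphs and quadratic polynomials\<close>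

text \<open>\<open>(-p, 1)\<close> is the upward normal of a graph of slope \<open>p\<close>.\<close>

definition graph_integrand :: "((real^'n) \<times> real \<Rightarrow> real) \<Rightarrow> real^'n \<Rightarrow> real" where
  "graph_integrand \<Phi> p = hom_ext \<Phi> (- p, 1)"

definition Phi_minimal_on ::
    "((real^'n) \<times> real \<Rightarrow> real) \<Rightarrow> (real^'n) set \<Rightarrow> (real^'n \<Rightarrow> real) \<Rightarrow> bool" where
  "Phi_minimal_on \<Phi> \<Omega> u \<longleftrightarrow>
     smooth_on \<Omega> u \<and>
     (\<forall>x\<in>\<Omega>. divergence (\<lambda>y. gradient (graph_integrand \<Phi>) (gradient u y)) x = 0)"

text \<open>Since \<open>A\<close> is symmetric, \<open>A \<noteq> 0\<close> says that the degree-two part does not vanish.\<close>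

definition quadratic_polynomial :: "(real^'n \<Rightarrow> real) \<Rightarrow> bool" where
  "quadratic_polynomial u \<longleftrightarrow>
     (\<exists>(A :: real^'n^'n) b c. transpose A = A \<and> A \<noteq> 0 \<and>
        (\<forall>x. u x = x \<bullet> (A *v x) + b \<bullet> x + c))"

end

theory Submission
  imports Defs
begin

text \<open>
  Split \<open>\<real>\<^sup>6 = \<real>\<^sup>3 \<times> \<real>\<^sup>3\<close> and take \<open>u (x, y) = (|x|\<^sup>2 - |y|\<^sup>2) / 2\<close>. Minimality becomes the
  ultrahyperbolic equation \<open>\<Delta>\<^sub>p \<phi> = \<Delta>\<^sub>q \<phi>\<close>, which for a function of \<open>s = |p|\<close> and \<open>t = |q|\<close>
  is the wave equation for \<open>s t \<phi>\<close>. Its solution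
  \<open>\<phi> = ((1 + (s + t)\<^sup>2)\<^bsup>3/2\<^esup> - (1 + (s - t)\<^sup>2)\<^bsup>3/2\<^esup>) / (6 s t)\<close> is the average of
  \<open>sqrt (1 + |p + O q|\<^sup>2)\<close> over all rotations \<open>O\<close>, hence convex. Homogenized, it becomes
  \<open>\<Phi> = M + s\<^sup>2 t\<^sup>2 / (3 M\<^sup>3)\<close>, where \<open>M\<close> is the larger solution of
  \<open>(M\<^sup>2 - s\<^sup>2) (M\<^sup>2 - t\<^sup>2) = z\<^sup>2 M\<^sup>2\<close>, and this is the stationary value over \<open>M\<close> of
  \<open>((s\<^sup>2 + t\<^sup>2 + z\<^sup>2) / M + M - s\<^sup>2 t\<^sup>2 / (3 M\<^sup>3)) / 2\<close>. So \<open>\<nabla>\<Phi>\<close> does not involve the derivative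
  of \<open>M\<close>, which fails to exist on the cone \<open>z = 0, s = t\<close>, and the second derivatives are
  Lipschitz across it although \<open>M\<close> is only Lipschitz there. The Hessian is an explicit sum of
  squares which vanishes in the radial direction only.
\<close>

section \<open>Lipschitz functions\<close>

definition is_lipschitz_on :: "'a::metric_space set \<Rightarrow> ('a \<Rightarrow> 'b::metric_space) \<Rightarrow> bool" where
  "is_lipschitz_on U f \<longleftrightarrow> (\<exists>L. L-lipschitz_on U f)"

lemma is_lipschitz_on_realI:
  fixes f :: "'a::metric_space \<Rightarrow> real"
  assumes "\<And>x y. x \<in> U \<Longrightarrow> y \<in> U \<Longrightarrow> \<bar>f x - f y\<bar> \<le> L * dist x y"
  shows "is_lipschitz_on U f"
proof -
  have "\<bar>L\<bar>-lipschitz_on U f"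
  proof (rule lipschitz_onI)
    fix x y assume "x \<in> U" "y \<in> U"
    then have "dist (f x) (f y) \<le> L * dist x y"
      using assms by (simp add: dist_real_def)
    also have "\<dots> \<le> \<bar>L\<bar> * dist x y"
      by (intro mult_right_mono) auto
    finally show "dist (f x) (f y) \<le> \<bar>L\<bar> * dist x y" .
  qed simp
  then show ?thesis
    unfolding is_lipschitz_on_def by blast
qed

lemma is_lipschitz_on_realD:
  fixes f :: "'a::metric_space \<Rightarrow> real"
  assumes "is_lipschitz_on U f"
  shows "\<exists>L\<ge>0. \<forall>x\<in>U. \<forall>y\<in>U. \<bar>f x - f y\<bar> \<le> L * dist x y"
  using assms unfolding is_lipschitz_on_def lipschitz_on_def dist_real_def by blast

lemma is_lipschitz_on_const: "is_lipschitz_on U (\<lambda>x. c)"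
  unfolding is_lipschitz_on_def by (blast intro: lipschitz_on_constant)

lemma is_lipschitz_on_add:
  fixes f g :: "'a::metric_space \<Rightarrow> real"
  shows "is_lipschitz_on U f \<Longrightarrow> is_lipschitz_on U g \<Longrightarrow> is_lipschitz_on U (\<lambda>x. f x + g x)"
  unfolding is_lipschitz_on_def by (blast intro: lipschitz_on_add)

lemma is_lipschitz_on_diff:
  fixes f g :: "'a::metric_space \<Rightarrow> real"
  shows "is_lipschitz_on U f \<Longrightarrow> is_lipschitz_on U g \<Longrightarrow> is_lipschitz_on U (\<lambda>x. f x - g x)"
  unfolding is_lipschitz_on_def by (blast intro: lipschitz_on_diff)

lemma is_lipschitz_on_minus:
  fixes f :: "'a::metric_space \<Rightarrow> real"
  shows "is_lipschitz_on U f \<Longrightarrow> is_lipschitz_on U (\<lambda>x. - f x)"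
  using is_lipschitz_on_diff[OF is_lipschitz_on_const, of U f 0] by simp

lemma is_lipschitz_on_bounded_linear:
  assumes "bounded_linear f"
  shows "is_lipschitz_on U f"
proof -
  obtain B where B: "B-lipschitz_on U f"
    by (rule bounded_linear.lipschitz_boundE[OF assms])
  then show ?thesis
    unfolding is_lipschitz_on_def by blast
qed

lemma is_lipschitz_on_norm:
  fixes f :: "'a::metric_space \<Rightarrow> 'b::real_normed_vector"
  assumes "is_lipschitz_on U f"
  shows "is_lipschitz_on U (\<lambda>x. norm (f x))"
proof -
  obtain L where L: "L-lipschitz_on U f"
    using assms unfolding is_lipschitz_on_def by blast
  show ?thesis
  proof (rule is_lipschitz_on_realI)
    fix x y assume "x \<in> U" "y \<in> U"
    then show "\<bar>norm (f x) - norm (f y)\<bar> \<le> L * dist x y"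
      using lipschitz_onD[OF L, of x y] norm_triangle_ineq3[of "f x" "f y"]
      by (simp add: dist_norm)
  qed
qed

lemma is_lipschitz_on_Pair:
  assumes "is_lipschitz_on U f" "is_lipschitz_on U g"
  shows "is_lipschitz_on U (\<lambda>x. (f x, g x))"
  using assms unfolding is_lipschitz_on_def by (blast intro: lipschitz_on_Pair)

lemma is_lipschitz_on_continuous_on: "is_lipschitz_on U f \<Longrightarrow> continuous_on U f"
  unfolding is_lipschitz_on_def using lipschitz_on_continuous_on by auto

lemma is_lipschitz_on_imp_bounded:
  fixes f :: "'a::metric_space \<Rightarrow> real"
  assumes "bounded U" "is_lipschitz_on U f"
  shows "\<exists>B\<ge>0. \<forall>x\<in>U. \<bar>f x\<bar> \<le> B"
proof -
  obtain e x0 where e: "\<And>x. x \<in> U \<Longrightarrow> dist x0 x \<le> e"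
    using assms(1) unfolding bounded_def by blast
  obtain L where L: "0 \<le> L" "\<And>x y. x \<in> U \<Longrightarrow> y \<in> U \<Longrightarrow> \<bar>f x - f y\<bar> \<le> L * dist x y"
    using is_lipschitz_on_realD[OF assms(2)] by blast
  show ?thesis
  proof (cases "U = {}")
    case False
    then obtain y where y: "y \<in> U" by blast
    have "\<bar>f x\<bar> \<le> \<bar>f y\<bar> + L * (2 * e)" if "x \<in> U" for x
    proof -
      have "dist x y \<le> 2 * e"
        using dist_triangle3[of x y x0] e[OF that] e[OF y] by simp
      then have "L * dist x y \<le> L * (2 * e)"
        using L(1) by (rule mult_left_mono)
      then show ?thesis
        using L(2)[OF that y] by linarith
    qed
    then show ?thesis
      by (intro exI[of _ "\<bar>\<bar>f y\<bar> + L * (2 * e)\<bar>"]) fastforce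
  qed auto
qed

lemma is_lipschitz_on_mult:
  fixes f g :: "'a::metric_space \<Rightarrow> real"
  assumes U: "bounded U" and f: "is_lipschitz_on U f" and g: "is_lipschitz_on U g"
  shows "is_lipschitz_on U (\<lambda>x. f x * g x)"
proof -
  obtain A where A: "0 \<le> A" "\<And>x. x \<in> U \<Longrightarrow> \<bar>f x\<bar> \<le> A"
    using is_lipschitz_on_imp_bounded[OF U f] by blast
  obtain B where B: "0 \<le> B" "\<And>x. x \<in> U \<Longrightarrow> \<bar>g x\<bar> \<le> B"
    using is_lipschitz_on_imp_bounded[OF U g] by blast
  obtain K where K: "0 \<le> K" "\<And>x y. x \<in> U \<Longrightarrow> y \<in> U \<Longrightarrow> \<bar>f x - f y\<bar> \<le> K * dist x y"
    using is_lipschitz_on_realD[OF f] by blast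
  obtain L where L: "0 \<le> L" "\<And>x y. x \<in> U \<Longrightarrow> y \<in> U \<Longrightarrow> \<bar>g x - g y\<bar> \<le> L * dist x y"
    using is_lipschitz_on_realD[OF g] by blast
  show ?thesis
  proof (rule is_lipschitz_on_realI)
    fix x y assume x: "x \<in> U" and y: "y \<in> U"
    have "f x * g x - f y * g y = f x * (g x - g y) + (f x - f y) * g y"
      by (simp add: algebra_simps)
    also have "\<bar>\<dots>\<bar> \<le> \<bar>f x\<bar> * \<bar>g x - g y\<bar> + \<bar>f x - f y\<bar> * \<bar>g y\<bar>"
      by (metis abs_mult abs_triangle_ineq)
    also have "\<dots> \<le> A * (L * dist x y) + (K * dist x y) * B"
      using A B K L x y by (intro add_mono mult_mono) auto
    finally show "\<bar>f x * g x - f y * g y\<bar> \<le> (A * L + K * B) * dist x y"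
      by (simp add: algebra_simps)
  qed
qed

lemma is_lipschitz_on_power:
  fixes f :: "'a::metric_space \<Rightarrow> real"
  assumes "bounded U" "is_lipschitz_on U f"
  shows "is_lipschitz_on U (\<lambda>x. f x ^ n)"
  by (induction n) (auto intro: is_lipschitz_on_const is_lipschitz_on_mult assms)

lemma is_lipschitz_on_inverse:
  fixes f :: "'a::metric_space \<Rightarrow> real"
  assumes f: "is_lipschitz_on U f" and m: "0 < m" "\<And>x. x \<in> U \<Longrightarrow> m \<le> f x"
  shows "is_lipschitz_on U (\<lambda>x. inverse (f x))"
proof -
  obtain L where L: "0 \<le> L" "\<And>x y. x \<in> U \<Longrightarrow> y \<in> U \<Longrightarrow> \<bar>f x - f y\<bar> \<le> L * dist x y"
    using is_lipschitz_on_realD[OF f] by blast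
  show ?thesis
  proof (rule is_lipschitz_on_realI)
    fix x y assume x: "x \<in> U" and y: "y \<in> U"
    have pos: "0 < f x" "0 < f y"
      using m(1) m(2)[OF x] m(2)[OF y] by linarith+
    then have "\<bar>inverse (f x) - inverse (f y)\<bar> = \<bar>f x - f y\<bar> / (f x * f y)"
      by (simp add: divide_simps abs_minus_commute)
    also have "\<dots> \<le> (L * dist x y) / (m * m)"
      using L x y m pos by (intro frac_le mult_mono) (auto simp: less_imp_le)
    finally show "\<bar>inverse (f x) - inverse (f y)\<bar> \<le> L / (m * m) * dist x y"
      by simp
  qed
qed

text \<open>The value at the zeros of \<open>d\<close> is the junk value \<open>0\<close> of the division, which is the limit.\<close>

lemma is_lipschitz_on_mult_divide:
  fixes f g d :: "'a::metric_space \<Rightarrow> real"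
  assumes f: "is_lipschitz_on U f" and g: "is_lipschitz_on U g" and d: "is_lipschitz_on U d"
    and C: "0 \<le> C"
    and bf: "\<And>x. x \<in> U \<Longrightarrow> \<bar>f x\<bar> \<le> C * d x" and bg: "\<And>x. x \<in> U \<Longrightarrow> \<bar>g x\<bar> \<le> C * d x"
    and d0: "\<And>x. x \<in> U \<Longrightarrow> 0 \<le> d x"
  shows "is_lipschitz_on U (\<lambda>x. f x * g x / d x)"
proof -
  obtain K where K: "0 \<le> K" "\<And>x y. x \<in> U \<Longrightarrow> y \<in> U \<Longrightarrow> \<bar>f x - f y\<bar> \<le> K * dist x y"
    using is_lipschitz_on_realD[OF f] by blast
  obtain L where L: "0 \<le> L" "\<And>x y. x \<in> U \<Longrightarrow> y \<in> U \<Longrightarrow> \<bar>g x - g y\<bar> \<le> L * dist x y"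
    using is_lipschitz_on_realD[OF g] by blast
  obtain N where N: "0 \<le> N" "\<And>x y. x \<in> U \<Longrightarrow> y \<in> U \<Longrightarrow> \<bar>d x - d y\<bar> \<le> N * dist x y"
    using is_lipschitz_on_realD[OF d] by blast
  define B where "B = K * C + C * L + C * C * N"
  have B0: "0 \<le> B"
    using K L N C by (simp add: B_def)
  \<comment> \<open>By symmetry the larger denominator may sit at \<open>x\<close>. Then
    \<open>f y\<close> is also bounded by \<open>C * d x\<close>, so all quotients in the
    telescoping below are at most \<open>C\<close>; its three terms give the three summands of
    \<open>B\<close>.\<close>
  have *: "\<bar>f x * g x / d x - f y * g y / d y\<bar> \<le> B * dist x y"
    if x: "x \<in> U" and y: "y \<in> U" and le: "d y \<le> d x" for x y
  proof (cases "d y = 0")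
    case y0: True
    show ?thesis
    proof (cases "d x = 0")
      case True
      then show ?thesis
        using y0 B0 by simp
    next
      case False
      then have dx: "0 < d x"
        using d0[OF x] by simp
      have "\<bar>f x * g x / d x\<bar> = \<bar>f x\<bar> * \<bar>g x\<bar> / d x"
        using dx by (simp add: abs_mult)
      also have "\<dots> \<le> (C * d x) * (C * d x) / d x"
        using bf[OF x] bg[OF x] dx C by (intro divide_right_mono mult_mono) auto
      also have "\<dots> = C * C * \<bar>d x - d y\<bar>"
        using dx y0 by simp
      also have "\<dots> \<le> C * C * (N * dist x y)"
        using N(2)[OF x y] C by (intro mult_left_mono) auto
      also have "\<dots> \<le> B * dist x y"
        using K L C by (simp add: B_def algebra_simps)
      finally show ?thesis
        using y0 by simp
    qed
  next
    case False
    then have dy: "0 < d y"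
      using d0[OF y] by simp
    then have dx: "0 < d x"
      using le by simp
    have q: "\<bar>g x\<bar> / d x \<le> C" "\<bar>f y\<bar> / d x \<le> C" "\<bar>g y\<bar> / d y \<le> C"
      using order_trans[OF bf[OF y] mult_left_mono[OF le C]] bg[OF x] bg[OF y] dx dy
      by (simp_all add: pos_divide_le_eq)
    have "f x * g x / d x - f y * g y / d y
        = (f x - f y) * (g x / d x) + (f y / d x) * (g x - g y)
          - (f y / d x) * (g y / d y) * (d x - d y)"
      using dx dy by (simp add: field_simps)
    also have "\<bar>\<dots>\<bar> \<le> \<bar>f x - f y\<bar> * (\<bar>g x\<bar> / d x) + (\<bar>f y\<bar> / d x) * \<bar>g x - g y\<bar>
          + (\<bar>f y\<bar> / d x) * (\<bar>g y\<bar> / d y) * \<bar>d x - d y\<bar>"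
    proof -
      have tri: "\<bar>u + v - w\<bar> \<le> \<bar>u\<bar> + \<bar>v\<bar> + \<bar>w\<bar>" for u v w :: real
        by linarith
      show ?thesis
        using tri[of "(f x - f y) * (g x / d x)" "(f y / d x) * (g x - g y)"
            "(f y / d x) * (g y / d y) * (d x - d y)"] dx dy
        by (simp only: abs_mult abs_divide abs_of_pos)
    qed
    also have "\<dots> \<le> (K * dist x y) * C + C * (L * dist x y) + C * C * (N * dist x y)"
      using q K(2)[OF x y] L(2)[OF x y] N(2)[OF x y] K(1) L(1) N(1) C dx dy
      by (intro add_mono mult_mono) auto
    finally show ?thesis
      by (simp add: B_def algebra_simps)
  qed
  show ?thesis
  proof (rule is_lipschitz_on_realI)
    fix x y assume "x \<in> U" "y \<in> U"
    then show "\<bar>f x * g x / d x - f y * g y / d y\<bar> \<le> B * dist x y"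
      using *[of x y] *[of y x] by (cases "d y \<le> d x") (auto simp: abs_minus_commute dist_commute)
  qed
qed

lemma is_lipschitz_on_imp_holder_on:
  assumes "is_lipschitz_on U f"
  shows "holder_on 1 U f"
proof -
  obtain L where "\<And>x y. x \<in> U \<Longrightarrow> y \<in> U \<Longrightarrow> \<bar>f x - f y\<bar> \<le> L * dist x y"
    using is_lipschitz_on_realD[OF assms] by blast
  then show ?thesis
    unfolding holder_on_def by auto
qed

lemma is_lipschitz_on_cong:
  "(\<And>x. x \<in> U \<Longrightarrow> f x = g x) \<Longrightarrow> is_lipschitz_on U f \<longleftrightarrow> is_lipschitz_on U g"
  unfolding is_lipschitz_on_def lipschitz_on_def by auto

text \<open>Lipschitz only at the point: this is where a non-differentiable factor is tolerated.\<close>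

lemma has_derivative_lipschitz_mult_null:
  fixes h :: "'a::real_normed_vector \<Rightarrow> real" and r :: "'a \<Rightarrow> 'b::real_normed_vector"
  assumes h: "\<And>y. \<bar>h y\<bar> \<le> L * norm (y - x)"
    and r: "isCont r x" "r x = 0"
  shows "((\<lambda>y. h y *\<^sub>R r y) has_derivative (\<lambda>_. 0)) (at x)"
proof -
  have hx: "h x = 0"
    using h[of x] by simp
  have "((\<lambda>y. L * norm (r y)) \<longlongrightarrow> L * norm (r x)) (at x)"
    using r(1) by (intro tendsto_intros) (simp add: isCont_def)
  then have lim: "((\<lambda>y. L * norm (r y)) \<longlongrightarrow> 0) (at x)"
    using r(2) by simp
  have "((\<lambda>y. norm (h y *\<^sub>R r y) / norm (y - x)) \<longlongrightarrow> 0) (at x)"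
  proof (rule tendsto_sandwich[OF _ _ tendsto_const lim])
    show "\<forall>\<^sub>F y in at x. norm (h y *\<^sub>R r y) / norm (y - x) \<le> L * norm (r y)"
    proof (rule eventually_at_topological[THEN iffD2], intro exI[of _ UNIV] conjI ballI impI open_UNIV UNIV_I)
      fix y assume "y \<noteq> x"
      have "\<bar>h y\<bar> * norm (r y) \<le> L * norm (y - x) * norm (r y)"
        using h[of y] by (rule mult_right_mono) simp
      then show "norm (h y *\<^sub>R r y) / norm (y - x) \<le> L * norm (r y)"
        using \<open>y \<noteq> x\<close> by (simp add: divide_simps algebra_simps)
    qed
  qed simp
  then show ?thesis
    using hx by (simp add: has_derivative_iff_norm)
qed

section \<open>Confocal coordinates\<close>

text \<open>
  \<open>M\<close> and \<open>D\<close> are half the sum and the product of the distances of \<open>(s, r)\<close> to the foci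
  \<open>(\<plusminus>t, 0)\<close>, so \<open>M\<close> is the semi-major axis of the confocal ellipse through \<open>(s, r)\<close>.
\<close>

lemma confocal_identities:
  fixes s t r M D :: real
  assumes s: "0 \<le> s" and t: "0 \<le> t"
    and M: "M = (sqrt (r\<^sup>2 + (s + t)\<^sup>2) + sqrt (r\<^sup>2 + (s - t)\<^sup>2)) / 2"
    and D: "D = sqrt (r\<^sup>2 + (s + t)\<^sup>2) * sqrt (r\<^sup>2 + (s - t)\<^sup>2)"
  shows "D = 2 * M\<^sup>2 - (s\<^sup>2 + t\<^sup>2 + r\<^sup>2)"
    and "D\<^sup>2 = (s\<^sup>2 + t\<^sup>2 + r\<^sup>2)\<^sup>2 - 4 * (s\<^sup>2 * t\<^sup>2)"
    and "(M\<^sup>2 - s\<^sup>2) * (M\<^sup>2 - t\<^sup>2) = r\<^sup>2 * M\<^sup>2"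
    and "s\<^sup>2 \<le> M\<^sup>2" and "t\<^sup>2 \<le> M\<^sup>2" and "0 \<le> D"
    and "M\<^sup>2 - s\<^sup>2 \<le> D" and "M\<^sup>2 - t\<^sup>2 \<le> D"
    and "M\<^sup>2 \<le> s\<^sup>2 + t\<^sup>2 + r\<^sup>2"
proof -
  define u where "u = sqrt (r\<^sup>2 + (s + t)\<^sup>2)"
  define v where "v = sqrt (r\<^sup>2 + (s - t)\<^sup>2)"
  have u: "u\<^sup>2 = r\<^sup>2 + (s + t)\<^sup>2" "0 \<le> u" and v: "v\<^sup>2 = r\<^sup>2 + (s - t)\<^sup>2" "0 \<le> v"
    by (simp_all add: u_def v_def)
  have MD: "M = (u + v) / 2" "D = u * v"
    by (simp_all add: M D u_def v_def)
  show D1: "D = 2 * M\<^sup>2 - (s\<^sup>2 + t\<^sup>2 + r\<^sup>2)"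
    using u(1) v(1) unfolding MD by (simp add: power2_eq_square field_simps)
  show D2: "D\<^sup>2 = (s\<^sup>2 + t\<^sup>2 + r\<^sup>2)\<^sup>2 - 4 * (s\<^sup>2 * t\<^sup>2)"
    unfolding MD power_mult_distrib u(1) v(1) by (simp add: power2_eq_square algebra_simps)
  show X: "(M\<^sup>2 - s\<^sup>2) * (M\<^sup>2 - t\<^sup>2) = r\<^sup>2 * M\<^sup>2"
  proof -
    \<comment> \<open>Equating the two expressions for \<open>D^2\<close> leaves
      \<open>M^4 - (s^2 + t^2 + r^2) M^2 + s^2 t^2 = 0\<close>, which is the claim expanded.\<close>
    have "(2 * M\<^sup>2 - (s\<^sup>2 + t\<^sup>2 + r\<^sup>2))\<^sup>2 = (s\<^sup>2 + t\<^sup>2 + r\<^sup>2)\<^sup>2 - 4 * (s\<^sup>2 * t\<^sup>2)"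
      using D1 D2 by simp
    then show ?thesis
      by (simp add: power2_eq_square algebra_simps)
  qed
  have uv: "\<bar>s + t\<bar> \<le> u" "\<bar>s - t\<bar> \<le> v"
    unfolding u_def v_def by (simp_all add: real_le_rsqrt)
  then have "s \<le> M" "t \<le> M"
    unfolding MD by (simp_all add: field_simps abs_le_iff)
  then show s2: "s\<^sup>2 \<le> M\<^sup>2" and t2: "t\<^sup>2 \<le> M\<^sup>2"
    using s t by (auto intro: power_mono)
  show D0: "0 \<le> D"
    unfolding MD using u v by simp
  have M0: "0 \<le> M"
    unfolding MD using u v by simp
  have "D \<le> s\<^sup>2 + t\<^sup>2 + r\<^sup>2"
    by (rule power2_le_imp_le) (auto simp: D2)
  then show "M\<^sup>2 \<le> s\<^sup>2 + t\<^sup>2 + r\<^sup>2"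
    using D1 by linarith
  have DM: "D * M\<^sup>2 = M\<^sup>2 * M\<^sup>2 - s\<^sup>2 * t\<^sup>2"
    unfolding D1 using X by (simp add: algebra_simps)
  \<comment> \<open>The difference of the two sides is \<open>s^2 (M^2 - t^2)\<close>. Cancelling
    \<open>M^2\<close> requires \<open>M\<close> nonzero; for \<open>M = 0\<close> the left side of
    the goal is nonpositive.\<close>
  have "(M\<^sup>2 - s\<^sup>2) * M\<^sup>2 \<le> D * M\<^sup>2"
    using mult_left_mono[OF t2, of "s\<^sup>2"] unfolding DM by (simp add: algebra_simps)
  then show "M\<^sup>2 - s\<^sup>2 \<le> D"
  proof (cases "M = 0")
    case True
    then show ?thesis using order_trans[OF _ D0, of "- s\<^sup>2"] by simp
  qed (simp add: mult_le_cancel_right)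
  have "(M\<^sup>2 - t\<^sup>2) * M\<^sup>2 \<le> D * M\<^sup>2"
    using mult_left_mono[OF s2, of "t\<^sup>2"] unfolding DM by (simp add: algebra_simps)
  then show "M\<^sup>2 - t\<^sup>2 \<le> D"
  proof (cases "M = 0")
    case True
    then show ?thesis using order_trans[OF _ D0, of "- t\<^sup>2"] by simp
  qed (simp add: mult_le_cancel_right)
qed

text \<open>
  The weights are minus the off-diagonal entries of the form, divided by the corresponding
  products of entries of its null vector \<open>(s, t, r)\<close>.
\<close>

lemma confocal_form_sum_of_squares:
  fixes s t r M D X Y u v w :: real
  assumes M: "0 < M" and D: "0 < D"
    and X: "X = M\<^sup>2 - s\<^sup>2" and Y: "Y = M\<^sup>2 - t\<^sup>2"
    and XY: "X * Y = r\<^sup>2 * M\<^sup>2" and DXY: "D = X + Y - r\<^sup>2"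
  shows "(1 / M - t\<^sup>2 / (3 * M ^ 3)) * u\<^sup>2 + (1 / M - s\<^sup>2 / (3 * M ^ 3)) * v\<^sup>2 + 1 / M * w\<^sup>2
      - 4 * (s * u) * (t * v) / (3 * M ^ 3)
      - (Y * (s * u) + X * (t * v) + M\<^sup>2 * (r * w))\<^sup>2 / (M ^ 5 * D)
    = (2 / (3 * M ^ 3) + X * Y / (M ^ 5 * D)) * (u * t - v * s)\<^sup>2
      + Y / (M ^ 3 * D) * (u * r - w * s)\<^sup>2 + X / (M ^ 3 * D) * (v * r - w * t)\<^sup>2"
proof -
  have s2: "s\<^sup>2 = M\<^sup>2 - X" and t2: "t\<^sup>2 = M\<^sup>2 - Y"
    using X Y by simp_all
  have MD: "M\<^sup>2 * D = M\<^sup>2 * X + M\<^sup>2 * Y - X * Y"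
    unfolding DXY XY by (simp add: algebra_simps)
  \<comment> \<open>After multiplication by \<open>3 M^5 D\<close>, \<open>e1\<close>,
    \<open>e2\<close> and (up to the factor \<open>3 M^2\<close>) \<open>e3\<close> match the
    coefficients of \<open>u^2\<close>, \<open>v^2\<close> and \<open>w^2\<close>. Eliminating
    \<open>D\<close>, \<open>s^2\<close>, \<open>t^2\<close> and \<open>r^2\<close> turns them into
    polynomial identities in \<open>M\<close>, \<open>X\<close>, \<open>Y\<close>.\<close>
  have e1: "3 * M\<^sup>2 * (M\<^sup>2 * D) - t\<^sup>2 * (M\<^sup>2 * D) - 3 * (Y\<^sup>2 * s\<^sup>2)
      = (2 * (M\<^sup>2 * D) + 3 * X * Y) * t\<^sup>2 + 3 * Y * (r\<^sup>2 * M\<^sup>2)"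
    unfolding MD XY[symmetric] s2 t2 by (simp add: power2_eq_square algebra_simps)
  have e2: "3 * M\<^sup>2 * (M\<^sup>2 * D) - s\<^sup>2 * (M\<^sup>2 * D) - 3 * (X\<^sup>2 * t\<^sup>2)
      = (2 * (M\<^sup>2 * D) + 3 * X * Y) * s\<^sup>2 + 3 * X * (r\<^sup>2 * M\<^sup>2)"
    unfolding MD XY[symmetric] s2 t2 by (simp add: power2_eq_square algebra_simps)
  have e3: "M\<^sup>2 * D - M\<^sup>2 * r\<^sup>2 = Y * s\<^sup>2 + X * t\<^sup>2"
    unfolding MD s2 t2 using XY by (simp add: power2_eq_square algebra_simps)
  have "3 * (M ^ 5 * D) * ((1 / M - t\<^sup>2 / (3 * M ^ 3)) * u\<^sup>2
      + (1 / M - s\<^sup>2 / (3 * M ^ 3)) * v\<^sup>2 + 1 / M * w\<^sup>2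
      - 4 * (s * u) * (t * v) / (3 * M ^ 3)
      - (Y * (s * u) + X * (t * v) + M\<^sup>2 * (r * w))\<^sup>2 / (M ^ 5 * D))
    = (3 * M\<^sup>2 * (M\<^sup>2 * D) - t\<^sup>2 * (M\<^sup>2 * D) - 3 * (Y\<^sup>2 * s\<^sup>2)) * u\<^sup>2
      + (3 * M\<^sup>2 * (M\<^sup>2 * D) - s\<^sup>2 * (M\<^sup>2 * D) - 3 * (X\<^sup>2 * t\<^sup>2)) * v\<^sup>2
      + 3 * M\<^sup>2 * (M\<^sup>2 * D - M\<^sup>2 * r\<^sup>2) * w\<^sup>2
      - 4 * (s * u) * (t * v) * (M\<^sup>2 * D) - 6 * (X * Y) * (s * u) * (t * v)
      - 6 * Y * M\<^sup>2 * (s * u) * (r * w) - 6 * X * M\<^sup>2 * (t * v) * (r * w)"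
    using M D by (simp add: field_simps power_numeral_reduce)
  also have "\<dots> = 3 * (M ^ 5 * D) * ((2 / (3 * M ^ 3) + X * Y / (M ^ 5 * D)) * (u * t - v * s)\<^sup>2
      + Y / (M ^ 3 * D) * (u * r - w * s)\<^sup>2 + X / (M ^ 3 * D) * (v * r - w * t)\<^sup>2)"
    unfolding e1 e2 e3 using M D by (simp add: field_simps power_numeral_reduce)
  finally show ?thesis
    using M D by simp
qed

section \<open>Differentiation of the coefficients\<close>

text \<open>The derivative of \<open>1 / m - b / (3 m^3)\<close> in \<open>m\<close> is
  \<open>- (m^2 - b) / m^4\<close>. For the coefficients \<open>kP\<close> and \<open>kQ\<close>
  below, \<open>m^2 - b\<close> is \<open>beta\<close> and \<open>alpha\<close>, which vanish where
  \<open>mu\<close> may fail to be differentiable.\<close>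

lemma inverse_minus_cube_has_derivative:
  fixes m b :: "'a::real_normed_vector \<Rightarrow> real"
  assumes m: "(m has_derivative m') (at x)" and b: "(b has_derivative b') (at x)" and x: "m x \<noteq> 0"
  shows "((\<lambda>y. 1 / m y - b y / (3 * m y ^ 3)) has_derivative
    (\<lambda>h. - ((m x)\<^sup>2 - b x) * m' h / m x ^ 4 - b' h / (3 * m x ^ 3))) (at x)"
  by (rule derivative_eq_intros m b refl | simp add: x)+
    (use x in \<open>simp add: fun_eq_iff field_simps power_numeral_reduce\<close>)

text \<open>When \<open>b x = (m x)^2\<close>, the partial derivative in \<open>m\<close> is zero,
  so a Lipschitz estimate for \<open>m\<close> at \<open>x\<close> replaces differentiability and
  only the variation of \<open>b\<close> contributes.\<close>

lemma inverse_minus_cube_has_derivative_degenerate: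
  fixes m b :: "'a::real_normed_vector \<Rightarrow> real"
  assumes m: "\<And>y. \<bar>m y - m x\<bar> \<le> L * norm (y - x)" and pos: "\<And>y. y \<noteq> 0 \<Longrightarrow> m y \<noteq> 0"
    and cont: "isCont m x" and b: "(b has_derivative b') (at x)" and x: "x \<noteq> 0" "b x = (m x)\<^sup>2"
  shows "((\<lambda>y. 1 / m y - b y / (3 * m y ^ 3)) has_derivative (\<lambda>h. - b' h / (3 * m x ^ 3))) (at x)"
proof -
  \<comment> \<open>The difference quotient in \<open>m\<close>, between \<open>m x\<close> and
    \<open>m y\<close> and with \<open>b y\<close> held fixed, of
    \<open>1 / m - b / (3 m^3)\<close>.\<close>
  let ?r = "\<lambda>y. - 1 / (m y * m x)
    + b y / 3 * ((m y)\<^sup>2 + m y * m x + (m x)\<^sup>2) / (m y ^ 3 * m x ^ 3)"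
  have mx: "m x \<noteq> 0"
    using pos x by blast
  have bc: "isCont b x"
    using b has_derivative_continuous by blast
  have r: "isCont ?r x"
    using mx cont bc by (intro continuous_intros) auto
  have r0: "?r x = 0"
    using mx x by (simp add: field_simps power_numeral_reduce)
  have d1: "((\<lambda>y. (m y - m x) *\<^sub>R ?r y) has_derivative (\<lambda>_. 0)) (at x)"
    using m r r0 by (rule has_derivative_lipschitz_mult_null)
  have d2: "((\<lambda>y. 1 / m x - b y / (3 * m x ^ 3)) has_derivative (\<lambda>h. 0 - b' h / (3 * m x ^ 3))) (at x)"
    by (rule derivative_eq_intros b refl | simp add: mx)+
      (use mx in \<open>simp add: fun_eq_iff field_simps power_numeral_reduce\<close>)
  have "((\<lambda>y. (m y - m x) *\<^sub>R ?r y + (1 / m x - b y / (3 * m x ^ 3)))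
      has_derivative (\<lambda>h. - b' h / (3 * m x ^ 3))) (at x)"
    using has_derivative_add[OF d1 d2] by simp
  then show ?thesis
  proof (rule has_derivative_transform_within_open[where s = "- {0}"])
    fix y :: 'a assume "y \<in> - {0}"
    then have "m y \<noteq> 0"
      using pos by simp
    then show "(m y - m x) *\<^sub>R ?r y + (1 / m x - b y / (3 * m x ^ 3)) = 1 / m y - b y / (3 * m y ^ 3)"
      using mx by (simp add: field_simps power_numeral_reduce)
  qed (use x in auto)
qed

section \<open>The integrand\<close>

lemma bounded_linear_norm_square_has_derivative:
  fixes T :: "'a::real_normed_vector \<Rightarrow> 'b::real_inner"
  assumes "bounded_linear T"
  shows "((\<lambda>y. (norm (T y))\<^sup>2) has_derivative (\<lambda>h. 2 * (T x \<bullet> T h))) (at x)"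
  unfolding power2_norm_eq_inner
  by (rule has_derivative_eq_rhs[OF has_derivative_inner[OF
          bounded_linear_imp_has_derivative[OF assms] bounded_linear_imp_has_derivative[OF assms]]])
    (simp add: fun_eq_iff inner_commute)

lemmas norm_square_has_derivative = bounded_linear_norm_square_has_derivative[OF bounded_linear_ident]

text \<open>The maps are the orthogonal projections onto three complementary subspaces; idempotence
  and symmetry follow from the axioms. Dimensions are left open: regularity and ellipticity hold for
  every splitting, and only minimality needs two blocks of dimension 3.\<close>

locale orthogonal_splitting =
  fixes P Q R :: "'a::euclidean_space \<Rightarrow> 'a"
  assumes linear: "linear P" "linear Q" "linear R"
    and split: "P x + Q x + R x = x"
    and orthogonal: "P x \<bullet> Q y = 0" "P x \<bullet> R y = 0" "Q x \<bullet> R y = 0"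
begin

lemma bounded_linear: "bounded_linear P" "bounded_linear Q" "bounded_linear R"
  using linear by (simp_all add: linear_conv_bounded_linear)

lemma orthogonal': "Q x \<bullet> P y = 0" "R x \<bullet> P y = 0" "R x \<bullet> Q y = 0"
  using orthogonal by (simp_all add: inner_commute)

lemma inner_split: "x \<bullet> y = P x \<bullet> P y + Q x \<bullet> Q y + R x \<bullet> R y"
proof -
  have "x \<bullet> y = (P x + Q x + R x) \<bullet> (P y + Q y + R y)"
    by (simp add: split)
  then show ?thesis
    by (simp add: inner_add_left inner_add_right orthogonal orthogonal')
qed

lemma inner_left: "P x \<bullet> y = P x \<bullet> P y" "Q x \<bullet> y = Q x \<bullet> Q y" "R x \<bullet> y = R x \<bullet> R y"
proof -
  have "P x \<bullet> y = P x \<bullet> (P y + Q y + R y)" "Q x \<bullet> y = Q x \<bullet> (P y + Q y + R y)"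
    "R x \<bullet> y = R x \<bullet> (P y + Q y + R y)"
    by (simp_all add: split)
  then show "P x \<bullet> y = P x \<bullet> P y" "Q x \<bullet> y = Q x \<bullet> Q y" "R x \<bullet> y = R x \<bullet> R y"
    by (simp_all add: inner_add_right orthogonal orthogonal')
qed

lemma inner_expand: "x \<bullet> y = P x \<bullet> y + Q x \<bullet> y + R x \<bullet> y"
  by (simp add: split flip: inner_add_left)

lemma norm_split: "(norm x)\<^sup>2 = (norm (P x))\<^sup>2 + (norm (Q x))\<^sup>2 + (norm (R x))\<^sup>2"
  using inner_split[of x x] by (simp add: power2_norm_eq_inner)

lemma norm_square_has_derivative_components:
  "((\<lambda>y. (norm (P y))\<^sup>2) has_derivative (\<lambda>h. 2 * (P x \<bullet> h))) (at x)"
  "((\<lambda>y. (norm (Q y))\<^sup>2) has_derivative (\<lambda>h. 2 * (Q x \<bullet> h))) (at x)"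
  "((\<lambda>y. (norm (R y))\<^sup>2) has_derivative (\<lambda>h. 2 * (R x \<bullet> h))) (at x)"
proof -
  show "((\<lambda>y. (norm (P y))\<^sup>2) has_derivative (\<lambda>h. 2 * (P x \<bullet> h))) (at x)"
    "((\<lambda>y. (norm (Q y))\<^sup>2) has_derivative (\<lambda>h. 2 * (Q x \<bullet> h))) (at x)"
    "((\<lambda>y. (norm (R y))\<^sup>2) has_derivative (\<lambda>h. 2 * (R x \<bullet> h))) (at x)"
    using bounded_linear[THEN bounded_linear_norm_square_has_derivative, where x = x]
    by (simp_all only: inner_left[of x, symmetric])
qed

text \<open>\<open>mu\<close> and \<open>delta\<close> are \<open>M\<close> and \<open>D\<close> for \<open>(s, t, r) = (|P x|, |Q x|, |R x|)\<close>.\<close>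

definition mu :: "'a \<Rightarrow> real" where
  "mu x = (norm (R x, norm (P x) + norm (Q x)) + norm (R x, norm (P x) - norm (Q x))) / 2"

definition delta :: "'a \<Rightarrow> real" where
  "delta x = norm (R x, norm (P x) + norm (Q x)) * norm (R x, norm (P x) - norm (Q x))"

definition alpha :: "'a \<Rightarrow> real" where
  "alpha x = (mu x)\<^sup>2 - (norm (P x))\<^sup>2"

definition beta :: "'a \<Rightarrow> real" where
  "beta x = (mu x)\<^sup>2 - (norm (Q x))\<^sup>2"

lemma confocal:
  shows delta_eq: "delta x = 2 * (mu x)\<^sup>2 - (norm x)\<^sup>2"
    and delta_square: "(delta x)\<^sup>2 = ((norm x)\<^sup>2)\<^sup>2 - 4 * ((norm (P x))\<^sup>2 * (norm (Q x))\<^sup>2)"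
    and alpha_beta: "alpha x * beta x = (norm (R x))\<^sup>2 * (mu x)\<^sup>2"
    and alpha_nonneg: "0 \<le> alpha x" and beta_nonneg: "0 \<le> beta x" and delta_nonneg: "0 \<le> delta x"
    and alpha_le_delta: "alpha x \<le> delta x" and beta_le_delta: "beta x \<le> delta x"
    and mu_le_norm: "mu x \<le> norm x"
proof -
  have m: "mu x = (sqrt ((norm (R x))\<^sup>2 + (norm (P x) + norm (Q x))\<^sup>2)
      + sqrt ((norm (R x))\<^sup>2 + (norm (P x) - norm (Q x))\<^sup>2)) / 2"
    by (simp add: mu_def norm_Pair)
  have d: "delta x = sqrt ((norm (R x))\<^sup>2 + (norm (P x) + norm (Q x))\<^sup>2)
      * sqrt ((norm (R x))\<^sup>2 + (norm (P x) - norm (Q x))\<^sup>2)"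
    by (simp add: delta_def norm_Pair)
  note c = confocal_identities[OF norm_ge_zero norm_ge_zero m d]
  show "delta x = 2 * (mu x)\<^sup>2 - (norm x)\<^sup>2"
    "(delta x)\<^sup>2 = ((norm x)\<^sup>2)\<^sup>2 - 4 * ((norm (P x))\<^sup>2 * (norm (Q x))\<^sup>2)"
    using c(1,2) by (simp_all add: norm_split[of x])
  show "alpha x * beta x = (norm (R x))\<^sup>2 * (mu x)\<^sup>2" "0 \<le> alpha x" "0 \<le> beta x" "0 \<le> delta x"
    "alpha x \<le> delta x" "beta x \<le> delta x"
    using c(3-8) by (simp_all add: alpha_def beta_def)
  show "mu x \<le> norm x"
    by (rule power2_le_imp_le) (use c(9) in \<open>simp_all add: norm_split[of x]\<close>)
qed

lemma mu_nonneg: "0 \<le> mu x"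
  by (simp add: mu_def)

lemma norm_le_mu: "norm x \<le> 2 * mu x"
proof (rule power2_le_imp_le)
  show "(norm x)\<^sup>2 \<le> (2 * mu x)\<^sup>2"
    using delta_eq[of x] delta_nonneg[of x] zero_le_power2[of "mu x"]
    unfolding power_mult_distrib power2_eq_square[of 2] by linarith
qed (simp add: mu_nonneg)

lemma mu_pos: "x \<noteq> 0 \<Longrightarrow> 0 < mu x"
  using norm_le_mu[of x] zero_less_norm_iff[of x] by linarith

text \<open>On the cone where \<open>mu\<close> may fail to be differentiable, \<open>alpha\<close>
  and \<open>beta\<close> are squeezed between \<open>0\<close> and \<open>delta\<close>, and their
  product controls \<open>R x\<close>. These are the factors that multiply the derivative of
  \<open>mu\<close> below.\<close>

lemma delta_zero:
  assumes "delta x = 0" "x \<noteq> 0"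
  shows "alpha x = 0" "beta x = 0" "R x = 0"
proof -
  show a: "alpha x = 0" and b: "beta x = 0"
    using assms(1) alpha_nonneg[of x] beta_nonneg[of x] alpha_le_delta[of x] beta_le_delta[of x]
    by simp_all
  show "R x = 0"
    using alpha_beta[of x] a mu_pos[OF assms(2)] by simp
qed

text \<open>The left side is the geometric mean of \<open>alpha x\<close> and \<open>beta x\<close>,
  both at most \<open>delta x\<close>. This bound makes \<open>R x\<close> an admissible numerator
  in the quotients by \<open>delta\<close>.\<close>

lemma norm_R_le: "norm (R x) * mu x \<le> delta x"
proof (rule power2_le_imp_le)
  have "(norm (R x) * mu x)\<^sup>2 = alpha x * beta x"
    by (simp add: alpha_beta power_mult_distrib)
  also have "\<dots> \<le> delta x * delta x"
    using alpha_nonneg beta_nonneg alpha_le_delta beta_le_delta delta_nonneg by (intro mult_mono)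
  finally show "(norm (R x) * mu x)\<^sup>2 \<le> (delta x)\<^sup>2"
    by (simp add: power2_eq_square)
qed (rule delta_nonneg)

section \<open>Lipschitz continuity and differentiation of \<open>mu\<close>\<close>

lemma mu_lipschitz: "is_lipschitz_on U mu"
  and delta_factors_lipschitz:
    "is_lipschitz_on U (\<lambda>x. norm (R x, norm (P x) + norm (Q x)))"
    "is_lipschitz_on U (\<lambda>x. norm (R x, norm (P x) - norm (Q x)))"
proof -
  note n = is_lipschitz_on_norm[OF is_lipschitz_on_bounded_linear[OF bounded_linear(1)], of U]
    is_lipschitz_on_norm[OF is_lipschitz_on_bounded_linear[OF bounded_linear(2)], of U]
  note r = is_lipschitz_on_bounded_linear[OF bounded_linear(3), of U]
  show p: "is_lipschitz_on U (\<lambda>x. norm (R x, norm (P x) + norm (Q x)))"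
    by (intro is_lipschitz_on_norm is_lipschitz_on_Pair is_lipschitz_on_add n r)
  show m: "is_lipschitz_on U (\<lambda>x. norm (R x, norm (P x) - norm (Q x)))"
    by (intro is_lipschitz_on_norm is_lipschitz_on_Pair is_lipschitz_on_diff n r)
  obtain L where "L-lipschitz_on U (\<lambda>x. norm (R x, norm (P x) + norm (Q x))
      + norm (R x, norm (P x) - norm (Q x)))"
    using is_lipschitz_on_add[OF p m] unfolding is_lipschitz_on_def by blast
  from lipschitz_on_cmult[OF this, of "1 / 2"] have "(1 / 2 * L)-lipschitz_on U mu"
    unfolding mu_def[abs_def] by simp
  then show "is_lipschitz_on U mu"
    unfolding is_lipschitz_on_def by blast
qed

lemma mu_continuous: "isCont mu x"
  using is_lipschitz_on_continuous_on[OF mu_lipschitz[of UNIV]]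
  by (simp add: continuous_on_eq_continuous_at)

definition mu_slope :: "'a \<Rightarrow> 'a \<Rightarrow> real" where
  "mu_slope x h = beta x * (P x \<bullet> h) + alpha x * (Q x \<bullet> h) + (mu x)\<^sup>2 * (R x \<bullet> h)"

text \<open>The definition of \<open>mu\<close> involves \<open>norm (P x)\<close> and
  \<open>norm (Q x)\<close>, which have kinks at zeros of \<open>P x\<close> and \<open>Q x\<close>.
  Nested square roots of expressions in squared norms avoid them; both radicands are positive when
  \<open>delta x\<close> is.\<close>

lemma mu_has_derivative:
  assumes "0 < delta x" "x \<noteq> 0"
  shows "(mu has_derivative (\<lambda>h. mu_slope x h / (mu x * delta x))) (at x)"
proof -
  have pos: "0 < mu x"
    using mu_pos assms by blast
  have nd: "((\<lambda>y. (norm y)\<^sup>2) has_derivative (\<lambda>h. 2 * (x \<bullet> h))) (at x)"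
    by (rule norm_square_has_derivative)
  have ms: "mu = (\<lambda>y. sqrt (((norm y)\<^sup>2 + delta y) / 2))"
    using mu_nonneg by (simp add: fun_eq_iff delta_eq)
  define g where "g y = ((norm y)\<^sup>2)\<^sup>2 - 4 * ((norm (P y))\<^sup>2 * (norm (Q y))\<^sup>2)" for y
  have g_eq: "g y = (delta y)\<^sup>2" for y
    by (simp only: g_def delta_square)
  have ds: "delta = (\<lambda>y. sqrt (g y))"
    by (simp add: g_eq delta_nonneg)
  define g' where "g' h = 4 * (norm x)\<^sup>2 * (x \<bullet> h)
      - 8 * ((norm (Q x))\<^sup>2 * (P x \<bullet> h) + (norm (P x))\<^sup>2 * (Q x \<bullet> h))" for h
  have g: "(g has_derivative g') (at x)"
    unfolding g_def[abs_def]
    by (rule has_derivative_eq_rhs, (rule derivative_intros norm_square_has_derivative_components nd)+)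
      (simp add: fun_eq_iff g'_def algebra_simps)
  have gx: "sqrt (g x) = delta x" "0 < g x"
    using assms(1) by (simp_all add: g_eq)
  have d: "(delta has_derivative (\<lambda>h. g' h * (inverse (delta x) / 2))) (at x)"
    using has_derivative_real_sqrt[OF gx(2) g] unfolding gx(1) ds[symmetric] .
  have mx: "sqrt (((norm x)\<^sup>2 + delta x) / 2) = mu x" "0 < ((norm x)\<^sup>2 + delta x) / 2"
    using fun_cong[OF ms, of x] assms by (simp_all add: add_nonneg_pos)
  have "((\<lambda>y. ((norm y)\<^sup>2 + delta y) / 2) has_derivative
      (\<lambda>h. (2 * (x \<bullet> h) + g' h * (inverse (delta x) / 2)) / 2)) (at x)"
    by (rule has_derivative_eq_rhs, (rule derivative_intros nd d)+) (simp_all add: fun_eq_iff)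
  from has_derivative_real_sqrt[OF mx(2) this]
  have m: "(mu has_derivative
      (\<lambda>h. (2 * (x \<bullet> h) + g' h * (inverse (delta x) / 2)) / 2 * (inverse (mu x) / 2))) (at x)"
    unfolding mx(1) ms[symmetric] .
  have "(2 * (x \<bullet> h) + g' h * (inverse (delta x) / 2)) / 2 * (inverse (mu x) / 2)
      = mu_slope x h / (mu x * delta x)" for h
  proof -
    have x: "x \<bullet> h = P x \<bullet> h + Q x \<bullet> h + R x \<bullet> h"
      by (rule inner_expand)
    have "4 * (x \<bullet> h) * delta x + g' h = 8 * mu_slope x h"
      unfolding g'_def mu_slope_def alpha_def beta_def delta_eq x by (simp add: algebra_simps)
    then show ?thesis
      using pos assms(1) by (simp add: field_simps)
  qed
  then show ?thesis
    using m by (simp only:)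
qed

section \<open>The gradient field and its derivative\<close>

text \<open>\<open>kP\<close> and \<open>kQ\<close> are the coefficients of \<open>P x\<close> and
  \<open>Q x\<close> in the gradient of
  \<open>(|x|^2 / m + m - |P x|^2 |Q x|^2 / (3 m^3)) / 2\<close> for fixed \<open>m\<close>,
  evaluated at \<open>m = mu x\<close>.\<close>

definition kP :: "'a \<Rightarrow> real" where
  "kP x = 1 / mu x - (norm (Q x))\<^sup>2 / (3 * mu x ^ 3)"

definition kQ :: "'a \<Rightarrow> real" where
  "kQ x = 1 / mu x - (norm (P x))\<^sup>2 / (3 * mu x ^ 3)"

text \<open>Where \<open>delta x = 0\<close>, division by zero returns \<open>0\<close> and the
  first term drops out, which is the correct derivative there; likewise in \<open>dkQ\<close>. The
  value \<open>0\<close> that \<open>dkR\<close> takes there is harmless because it only multiplies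
  \<open>R x = 0\<close>.\<close>

definition dkP :: "'a \<Rightarrow> 'a \<Rightarrow> real" where
  "dkP x h = - beta x * mu_slope x h / (mu x ^ 5 * delta x) - 2 * (Q x \<bullet> h) / (3 * mu x ^ 3)"

definition dkQ :: "'a \<Rightarrow> 'a \<Rightarrow> real" where
  "dkQ x h = - alpha x * mu_slope x h / (mu x ^ 5 * delta x) - 2 * (P x \<bullet> h) / (3 * mu x ^ 3)"

definition dkR :: "'a \<Rightarrow> 'a \<Rightarrow> real" where
  "dkR x h = - mu_slope x h / (mu x ^ 3 * delta x)"

lemma mu_lipschitz_at: "\<exists>L. \<forall>y. \<bar>mu y - mu x\<bar> \<le> L * norm (y - x)"
  using is_lipschitz_on_realD[OF mu_lipschitz[of UNIV]] by (auto simp: dist_norm)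

text \<open>Where \<open>delta\<close> is positive this is the chain rule. Where it vanishes,
  \<open>beta x = 0\<close> says that the squared norm of \<open>Q x\<close> is
  \<open>(mu x)^2\<close>, the hypothesis of the degenerate rule.\<close>

lemma kP_has_derivative:
  assumes x: "x \<noteq> 0"
  shows "(kP has_derivative dkP x) (at x)"
proof (cases "delta x = 0")
  case True
  obtain L where "\<And>y. \<bar>mu y - mu x\<bar> \<le> L * norm (y - x)"
    using mu_lipschitz_at by blast
  then have "((\<lambda>y. 1 / mu y - (norm (Q y))\<^sup>2 / (3 * mu y ^ 3)) has_derivative
      (\<lambda>h. - (2 * (Q x \<bullet> h)) / (3 * mu x ^ 3))) (at x)"
    using delta_zero(2)[OF True x] mu_pos[THEN less_imp_neq] x
    by (intro inverse_minus_cube_has_derivative_degenerate mu_continuous norm_square_has_derivative_components)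
      (auto simp: beta_def)
  then show ?thesis
    using True by (simp add: kP_def[abs_def] dkP_def[abs_def])
next
  case False
  then have d: "0 < delta x"
    using delta_nonneg[of x] by simp
  show ?thesis
    unfolding kP_def[abs_def]
    by (rule has_derivative_eq_rhs, rule inverse_minus_cube_has_derivative[OF
          mu_has_derivative[OF d x] norm_square_has_derivative_components(2)])
      (use mu_pos[OF x] in \<open>auto simp: fun_eq_iff dkP_def beta_def power_numeral_reduce\<close>)
qed

lemma kQ_has_derivative:
  assumes x: "x \<noteq> 0"
  shows "(kQ has_derivative dkQ x) (at x)"
proof (cases "delta x = 0")
  case True
  obtain L where "\<And>y. \<bar>mu y - mu x\<bar> \<le> L * norm (y - x)"
    using mu_lipschitz_at by blast
  then have "((\<lambda>y. 1 / mu y - (norm (P y))\<^sup>2 / (3 * mu y ^ 3)) has_derivative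
      (\<lambda>h. - (2 * (P x \<bullet> h)) / (3 * mu x ^ 3))) (at x)"
    using delta_zero(1)[OF True x] mu_pos[THEN less_imp_neq] x
    by (intro inverse_minus_cube_has_derivative_degenerate mu_continuous norm_square_has_derivative_components)
      (auto simp: alpha_def)
  then show ?thesis
    using True by (simp add: kQ_def[abs_def] dkQ_def[abs_def])
next
  case False
  then have d: "0 < delta x"
    using delta_nonneg[of x] by simp
  show ?thesis
    unfolding kQ_def[abs_def]
    by (rule has_derivative_eq_rhs, rule inverse_minus_cube_has_derivative[OF
          mu_has_derivative[OF d x] norm_square_has_derivative_components(1)])
      (use mu_pos[OF x] in \<open>auto simp: fun_eq_iff dkQ_def alpha_def power_numeral_reduce\<close>)
qed

text \<open>
  \<open>1 / mu\<close> itself is not differentiable where \<open>delta\<close> vanishes, but \<open>R\<close> vanishes there.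
\<close>

lemma kR_has_derivative:
  assumes x: "x \<noteq> 0"
  shows "((\<lambda>y. (1 / mu y) *\<^sub>R R y) has_derivative (\<lambda>h. (1 / mu x) *\<^sub>R R h + dkR x h *\<^sub>R R x)) (at x)"
proof (cases "delta x = 0")
  case True
  then have Rx: "R x = 0"
    using delta_zero x by blast
  obtain L where L: "\<And>y. \<bar>mu y - mu x\<bar> \<le> L * norm (y - x)"
    using mu_lipschitz_at by blast
  have pos: "0 < mu x"
    using mu_pos x by blast
  have Rd: "(R has_derivative R) (at x)"
    using bounded_linear(3) by (rule bounded_linear_imp_has_derivative)
  have Rc: "isCont R x"
    using Rd has_derivative_continuous by blast
  have "((\<lambda>y. (mu y - mu x) *\<^sub>R ((- 1 / (mu y * mu x)) *\<^sub>R R y)) has_derivative (\<lambda>_. 0)) (at x)"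
    using L Rx pos mu_continuous Rc
    by (intro has_derivative_lipschitz_mult_null continuous_intros) auto
  \<comment> \<open>\<open>(1 / mu y) *\<^sub>R R y\<close> is split into its version with
    \<open>mu\<close> frozen at \<open>x\<close> and an error that is a product of two factors
    vanishing at \<open>x\<close>, one Lipschitz at \<open>x\<close> and one continuous.\<close>
  from has_derivative_add[OF this has_derivative_scaleR_right[OF Rd, of "1 / mu x"]]
  have "((\<lambda>y. (mu y - mu x) *\<^sub>R ((- 1 / (mu y * mu x)) *\<^sub>R R y) + (1 / mu x) *\<^sub>R R y)
      has_derivative (\<lambda>h. (1 / mu x) *\<^sub>R R h + dkR x h *\<^sub>R R x)) (at x)"
    by (simp add: Rx)
  then show ?thesis
  proof (rule has_derivative_transform_within_open[where s = "- {0}"])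
    fix y :: 'a assume "y \<in> - {0}"
    then have "0 < mu y"
      using mu_pos by simp
    then show "(mu y - mu x) *\<^sub>R ((- 1 / (mu y * mu x)) *\<^sub>R R y) + (1 / mu x) *\<^sub>R R y
        = (1 / mu y) *\<^sub>R R y"
      using pos by (simp add: field_simps flip: scaleR_add_left)
  qed (use x in auto)
next
  case False
  then have d: "0 < delta x"
    using delta_nonneg[of x] by simp
  have pos: "0 < mu x"
    using mu_pos x by blast
  have "((\<lambda>y. 1 / mu y) has_derivative dkR x) (at x)"
    unfolding inverse_eq_divide[symmetric]
    by (rule has_derivative_eq_rhs[OF Deriv.has_derivative_inverse[OF _ mu_has_derivative[OF d x]]])
      (use pos d in \<open>simp_all add: fun_eq_iff dkR_def divide_simps power_numeral_reduce\<close>)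
  from has_derivative_scaleR[OF this bounded_linear_imp_has_derivative[OF bounded_linear(3)]]
  show ?thesis .
qed

definition grad :: "'a \<Rightarrow> 'a" where
  "grad x = kP x *\<^sub>R P x + kQ x *\<^sub>R Q x + (1 / mu x) *\<^sub>R R x"

definition hess :: "'a \<Rightarrow> 'a \<Rightarrow> 'a" where
  "hess x h = kP x *\<^sub>R P h + dkP x h *\<^sub>R P x + (kQ x *\<^sub>R Q h + dkQ x h *\<^sub>R Q x)
    + ((1 / mu x) *\<^sub>R R h + dkR x h *\<^sub>R R x)"

lemma grad_has_derivative: "x \<noteq> 0 \<Longrightarrow> (grad has_derivative hess x) (at x)"
  unfolding grad_def[abs_def] hess_def[abs_def]
  by (intro has_derivative_add has_derivative_scaleR kP_has_derivative kQ_has_derivative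
      kR_has_derivative bounded_linear_imp_has_derivative bounded_linear)

section \<open>The integrand and its first derivative\<close>

definition Phi :: "'a \<Rightarrow> real" where
  "Phi x = mu x + (norm (P x))\<^sup>2 * (norm (Q x))\<^sup>2 / (3 * mu x ^ 3)"

text \<open>
  \<open>Phi y\<close> is the stationary value over \<open>m\<close>, attained at \<open>m = mu y\<close>, of the function
  \<open>(|y|\<^sup>2 / m + m - |P y|\<^sup>2 |Q y|\<^sup>2 / (3 m\<^sup>3)) / 2\<close>; so its derivative is the one for fixed \<open>m\<close>.
\<close>

lemma Phi_has_derivative:
  assumes x: "x \<noteq> 0"
  shows "(Phi has_derivative (\<lambda>h. grad x \<bullet> h)) (at x)"
proof -
  define w where "w y = (norm (P y))\<^sup>2 * (norm (Q y))\<^sup>2" for y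
  obtain L where L: "\<And>y. \<bar>mu y - mu x\<bar> \<le> L * norm (y - x)"
    using mu_lipschitz_at by blast
  have pos: "0 < mu x"
    using mu_pos x by blast
  have nd: "((\<lambda>y. (norm y)\<^sup>2) has_derivative (\<lambda>h. 2 * (x \<bullet> h))) (at x)"
    by (rule norm_square_has_derivative)
  have wd: "(w has_derivative (\<lambda>h. 2 * ((norm (P x))\<^sup>2 * (Q x \<bullet> h) + (norm (Q x))\<^sup>2 * (P x \<bullet> h)))) (at x)"
    unfolding w_def[abs_def]
    by (rule has_derivative_eq_rhs, (rule derivative_intros norm_square_has_derivative_components)+)
      (simp add: fun_eq_iff algebra_simps)
  \<comment> \<open>This is \<open>alpha_beta\<close> expanded. Solved for the squared norm of
    \<open>y\<close>, it turns the definition of \<open>Phi\<close> into the stationary expression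
    \<open>Phi_eq\<close>.\<close>
  have quartic: "(mu y)\<^sup>2 * (mu y)\<^sup>2 - (norm y)\<^sup>2 * (mu y)\<^sup>2 + w y = 0" for y
    using alpha_beta[of y] norm_split[of y] by (simp add: alpha_def beta_def w_def algebra_simps)
  have norm_eq: "(norm y)\<^sup>2 = (mu y)\<^sup>2 + w y / (mu y)\<^sup>2" if "y \<noteq> 0" for y
    using quartic[of y] mu_pos[OF that] by (simp add: field_simps)
  have Phi_eq: "Phi y = ((norm y)\<^sup>2 / mu y + mu y - w y / (3 * mu y ^ 3)) / 2" if "y \<noteq> 0" for y
    unfolding Phi_def w_def[symmetric] norm_eq[OF that]
    using mu_pos[OF that] by (simp add: field_simps power_numeral_reduce)
  \<comment> \<open>The difference quotient in \<open>m\<close>, between \<open>mu x\<close> and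
    \<open>mu y\<close>, of the stationary expression at \<open>y\<close>. Its value at
    \<open>x\<close> is the partial derivative in \<open>m\<close> there, so \<open>r0\<close> is
    stationarity.\<close>
  define r where "r y = (- (norm y)\<^sup>2 / (mu y * mu x) + 1
      + w y / 3 * ((mu y)\<^sup>2 + mu y * mu x + (mu x)\<^sup>2) / (mu y ^ 3 * mu x ^ 3)) / 2" for y
  have "isCont w x"
    using wd has_derivative_continuous by blast
  then have r: "isCont r x"
    unfolding r_def[abs_def]
    using pos mu_continuous by (intro continuous_intros) auto
  have r0: "r x = 0"
    unfolding r_def norm_eq[OF x] using pos by (simp add: field_simps power_numeral_reduce)
  have d1: "((\<lambda>y. (mu y - mu x) *\<^sub>R r y) has_derivative (\<lambda>_. 0)) (at x)"
    by (rule has_derivative_lipschitz_mult_null[where h = "\<lambda>y. mu y - mu x", OF L r r0])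
  have d2: "((\<lambda>y. ((norm y)\<^sup>2 / mu x + mu x - w y / (3 * mu x ^ 3)) / 2)
      has_derivative (\<lambda>h. grad x \<bullet> h)) (at x)"
  proof -
    have "((\<lambda>y. (1 / mu x * (norm y)\<^sup>2 + mu x - 1 / (3 * mu x ^ 3) * w y) * (1 / 2)) has_derivative
        (\<lambda>h. (1 / mu x * (2 * (x \<bullet> h)) + 0 - 1 / (3 * mu x ^ 3)
          * (2 * ((norm (P x))\<^sup>2 * (Q x \<bullet> h) + (norm (Q x))\<^sup>2 * (P x \<bullet> h)))) * (1 / 2))) (at x)"
      by (intro has_derivative_mult_left has_derivative_diff has_derivative_add
          has_derivative_mult_right nd wd has_derivative_const)
    moreover have "(1 / mu x * (2 * (x \<bullet> h)) + 0 - 1 / (3 * mu x ^ 3)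
          * (2 * ((norm (P x))\<^sup>2 * (Q x \<bullet> h) + (norm (Q x))\<^sup>2 * (P x \<bullet> h)))) * (1 / 2)
        = grad x \<bullet> h" for h
      using pos unfolding inner_expand[of x] grad_def kP_def kQ_def
      by (simp add: inner_add_left field_simps)
    ultimately show ?thesis
      by simp
  qed
  have "((\<lambda>y. (mu y - mu x) *\<^sub>R r y + ((norm y)\<^sup>2 / mu x + mu x - w y / (3 * mu x ^ 3)) / 2)
      has_derivative (\<lambda>h. grad x \<bullet> h)) (at x)"
    using has_derivative_add[OF d1 d2] by simp
  then show ?thesis
  proof (rule has_derivative_transform_within_open[where s = "- {0}"])
    fix y :: 'a assume "y \<in> - {0}"
    then have y: "y \<noteq> 0" "0 < mu y"
      using mu_pos by auto
    have alg: "(m - n) * ((- A / (m * n) + 1 + W / 3 * (m\<^sup>2 + m * n + n\<^sup>2) / (m ^ 3 * n ^ 3)) / 2)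
        + (A / n + n - W / (3 * n ^ 3)) / 2 = (A / m + m - W / (3 * m ^ 3)) / 2"
      if "0 < m" "0 < n" for m n A W :: real
      using that by (simp add: field_simps power_numeral_reduce)
    show "(mu y - mu x) *\<^sub>R r y + ((norm y)\<^sup>2 / mu x + mu x - w y / (3 * mu x ^ 3)) / 2 = Phi y"
      unfolding Phi_eq[OF y(1)] r_def real_scaleR_def by (rule alg[OF y(2) pos])
  qed (use x in auto)
qed

section \<open>Lipschitz continuity of the second derivatives\<close>

text \<open>Every term with \<open>delta\<close> in the denominator carries two factors among
  \<open>alpha x\<close>, \<open>beta x\<close>, \<open>R x \<bullet> h\<close> and
  \<open>R x \<bullet> v\<close>. Each is Lipschitz and at most a multiple of
  \<open>delta x\<close>, so \<open>is_lipschitz_on_mult_divide\<close> applies; away from the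
  origin \<open>1 / mu\<close> is Lipschitz as well.\<close>

lemma hess_lipschitz:
  assumes U: "bounded U" and e: "0 < e" "\<And>x. x \<in> U \<Longrightarrow> e \<le> norm x"
  shows "is_lipschitz_on U (\<lambda>x. hess x h \<bullet> v)"
proof -
  note const = is_lipschitz_on_const[of U] and mult = is_lipschitz_on_mult[OF U]
    and power = is_lipschitz_on_power[OF U]
  have mu_ge: "e / 2 \<le> mu x" if "x \<in> U" for x
    using e(2)[OF that] norm_le_mu[of x] by simp
  have e2: "0 < e / 2"
    using e by simp
  have inv: "is_lipschitz_on U (\<lambda>x. inverse (mu x))"
    using mu_lipschitz e2 mu_ge by (rule is_lipschitz_on_inverse)
  have nP: "is_lipschitz_on U (\<lambda>x. norm (P x))" and nQ: "is_lipschitz_on U (\<lambda>x. norm (Q x))"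
    by (intro is_lipschitz_on_norm is_lipschitz_on_bounded_linear bounded_linear)+
  have lin: "is_lipschitz_on U (\<lambda>x. P x \<bullet> w)" "is_lipschitz_on U (\<lambda>x. Q x \<bullet> w)"
    "is_lipschitz_on U (\<lambda>x. R x \<bullet> w)" for w
    by (intro is_lipschitz_on_bounded_linear
        bounded_linear_compose[OF bounded_linear_inner_left bounded_linear(1)]
        bounded_linear_compose[OF bounded_linear_inner_left bounded_linear(2)]
        bounded_linear_compose[OF bounded_linear_inner_left bounded_linear(3)])+
  have alpha: "is_lipschitz_on U alpha" and beta: "is_lipschitz_on U beta"
    unfolding alpha_def[abs_def] beta_def[abs_def]
    by (intro is_lipschitz_on_diff power mu_lipschitz nP nQ)+
  have delta: "is_lipschitz_on U delta"
    unfolding delta_def[abs_def] by (intro mult delta_factors_lipschitz)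
  \<comment> \<open>The summand \<open>1\<close> serves \<open>alpha\<close> and
    \<open>beta\<close>; the other comes from \<open>norm_R_le\<close> with \<open>mu x\<close> at
    least \<open>e / 2\<close>.\<close>
  define C where "C w = 1 + norm w / (e / 2)" for w :: 'a
  have C: "0 \<le> C w" "1 \<le> C w" for w
    using e by (simp_all add: C_def)
  have bR: "\<bar>R x \<bullet> w\<bar> \<le> C w * delta x" if "x \<in> U" for x w
  proof -
    have "\<bar>R x \<bullet> w\<bar> \<le> norm (R x) * norm w"
      by (rule Cauchy_Schwarz_ineq2)
    also have "\<dots> \<le> (delta x / (e / 2)) * norm w"
    proof (rule mult_right_mono)
      have "norm (R x) * (e / 2) \<le> norm (R x) * mu x"
        using mu_ge[OF that] by (rule mult_left_mono) simp
      then have "norm (R x) * (e / 2) \<le> delta x"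
        using norm_R_le[of x] by simp
      then show "norm (R x) \<le> delta x / (e / 2)"
        using e2 by (subst pos_le_divide_eq)
    qed simp
    also have "\<dots> \<le> C w * delta x"
      using delta_nonneg[of x] by (simp add: C_def algebra_simps)
    finally show ?thesis .
  qed
  have ba: "\<bar>alpha x\<bar> \<le> c * delta x" and bb: "\<bar>beta x\<bar> \<le> c * delta x" if "1 \<le> c" for x c
    using mult_right_mono[OF that delta_nonneg[of x]] alpha_le_delta[of x] beta_le_delta[of x]
      alpha_nonneg[of x] beta_nonneg[of x] by simp_all
  \<comment> \<open>The quotient lemma takes one constant for both numerators, so the bounds for
    \<open>h\<close> and \<open>v\<close> are merged.\<close>
  define c where "c = max (C h) (C v)"
  have c: "0 \<le> c" "1 \<le> c"
    using C[of h] unfolding c_def by linarith+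
  have bRh: "\<bar>R x \<bullet> h\<bar> \<le> c * delta x" and bRv: "\<bar>R x \<bullet> v\<bar> \<le> c * delta x" if "x \<in> U" for x
    using bR[OF that, of h] bR[OF that, of v] mult_right_mono[OF _ delta_nonneg[of x], of _ c]
    unfolding c_def by (meson max.cobounded1 max.cobounded2 order_trans)+
  note q = is_lipschitz_on_mult_divide[OF _ _ delta c(1) _ _ delta_nonneg]
  have q1: "is_lipschitz_on U (\<lambda>x. beta x * beta x / delta x)"
    "is_lipschitz_on U (\<lambda>x. beta x * alpha x / delta x)"
    "is_lipschitz_on U (\<lambda>x. alpha x * alpha x / delta x)"
    "is_lipschitz_on U (\<lambda>x. beta x * (R x \<bullet> h) / delta x)"
    "is_lipschitz_on U (\<lambda>x. alpha x * (R x \<bullet> h) / delta x)"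
    "is_lipschitz_on U (\<lambda>x. beta x * (R x \<bullet> v) / delta x)"
    "is_lipschitz_on U (\<lambda>x. alpha x * (R x \<bullet> v) / delta x)"
    "is_lipschitz_on U (\<lambda>x. (R x \<bullet> h) * (R x \<bullet> v) / delta x)"
    by (intro q alpha beta lin ba[OF c(2)] bb[OF c(2)] bRh bRv; assumption)+
  have kP_eq: "kP x = inverse (mu x) - (norm (Q x))\<^sup>2 * inverse (mu x) ^ 3 * (1 / 3)"
    and kQ_eq: "kQ x = inverse (mu x) - (norm (P x))\<^sup>2 * inverse (mu x) ^ 3 * (1 / 3)" for x
    by (simp_all add: kP_def kQ_def inverse_eq_divide power_one_over)
  have dkP_eq: "dkP x h = - (beta x * beta x / delta x * (P x \<bullet> h) + beta x * alpha x / delta x * (Q x \<bullet> h)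
        + (mu x)\<^sup>2 * (beta x * (R x \<bullet> h) / delta x)) * inverse (mu x) ^ 5
      - 2 / 3 * (Q x \<bullet> h) * inverse (mu x) ^ 3" for x
    unfolding dkP_def mu_slope_def divide_inverse inverse_mult_distrib power_inverse
    by (simp add: ring_distribs ac_simps)
  have dkQ_eq: "dkQ x h = - (beta x * alpha x / delta x * (P x \<bullet> h) + alpha x * alpha x / delta x * (Q x \<bullet> h)
        + (mu x)\<^sup>2 * (alpha x * (R x \<bullet> h) / delta x)) * inverse (mu x) ^ 5
      - 2 / 3 * (P x \<bullet> h) * inverse (mu x) ^ 3" for x
    unfolding dkQ_def mu_slope_def divide_inverse inverse_mult_distrib power_inverse
    by (simp add: ring_distribs ac_simps)
  have dkR_eq: "dkR x h * (R x \<bullet> v) =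
      - (beta x * (R x \<bullet> v) / delta x * (P x \<bullet> h) + alpha x * (R x \<bullet> v) / delta x * (Q x \<bullet> h)
        + (mu x)\<^sup>2 * ((R x \<bullet> h) * (R x \<bullet> v) / delta x)) * inverse (mu x) ^ 3" for x
    unfolding dkR_def mu_slope_def divide_inverse inverse_mult_distrib power_inverse
    by (simp add: ring_distribs ac_simps)
  have hess_eq: "hess x h \<bullet> v = kP x * (P h \<bullet> v) + dkP x h * (P x \<bullet> v)
      + (kQ x * (Q h \<bullet> v) + dkQ x h * (Q x \<bullet> v))
      + (inverse (mu x) * (R h \<bullet> v) + dkR x h * (R x \<bullet> v))" for x
    by (simp add: hess_def inner_add_left inverse_eq_divide)
  show ?thesis
    unfolding hess_eq kP_eq kQ_eq dkP_eq dkQ_eq dkR_eq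
    by (intro is_lipschitz_on_add is_lipschitz_on_diff is_lipschitz_on_minus mult power const inv
        lin nP nQ mu_lipschitz q1)
qed

section \<open>Positivity of the Hessian on tangent vectors\<close>

lemma kP_pos: "x \<noteq> 0 \<Longrightarrow> 0 < kP x" and kQ_pos: "x \<noteq> 0 \<Longrightarrow> 0 < kQ x"
proof -
  assume "x \<noteq> 0"
  then have pos: "0 < mu x"
    by (rule mu_pos)
  have "kP x = (2 * (mu x)\<^sup>2 + beta x) / (3 * mu x ^ 3)" "kQ x = (2 * (mu x)\<^sup>2 + alpha x) / (3 * mu x ^ 3)"
    using pos by (simp_all add: kP_def kQ_def alpha_def beta_def field_simps power_numeral_reduce)
  then show "0 < kP x" "0 < kQ x"
    using pos alpha_nonneg[of x] beta_nonneg[of x] by (simp_all add: add_pos_nonneg)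
qed

end

text \<open>\<open>u\<close> is the component of \<open>k\<close> along \<open>p\<close> and
  \<open>g\<close> the squared norm of the rest; for \<open>p = 0\<close> everything goes into
  \<open>g\<close>. Applied in each block, it reduces the Hessian to a form in three real
  variables.\<close>

lemma norm_square_decomposition:
  fixes p k :: "'a::real_inner"
  shows "\<exists>u g. 0 \<le> g \<and> (norm k)\<^sup>2 = u\<^sup>2 + g \<and> p \<bullet> k = norm p * u"
proof (cases "p = 0")
  case True
  then show ?thesis
    by (intro exI[of _ 0] exI[of _ "(norm k)\<^sup>2"]) simp
next
  case False
  have "((p \<bullet> k) / norm p)\<^sup>2 \<le> (norm k)\<^sup>2"
    using Cauchy_Schwarz_ineq[of p k] False
    by (simp add: power_divide power2_norm_eq_inner divide_le_eq mult.commute)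
  then show ?thesis
    using False by (intro exI[of _ "(p \<bullet> k) / norm p"] exI[of _ "(norm k)\<^sup>2 - ((p \<bullet> k) / norm p)\<^sup>2"]) simp
qed

context orthogonal_splitting
begin

text \<open>The parts of \<open>h\<close> orthogonal to \<open>P x\<close>, \<open>Q x\<close>,
  \<open>R x\<close> within their blocks contribute with positive weights. What remains is a form
  \<open>F\<close> in the radial components, nonnegative and zero only if \<open>(u, v, w)\<close>
  is parallel to \<open>(s, t, r)\<close>. Orthogonality to \<open>grad x\<close>, which pairs
  positively with \<open>x\<close>, excludes that direction.\<close>

lemma hess_positive:
  assumes x: "x \<noteq> 0" and h: "h \<noteq> 0" and perp: "grad x \<bullet> h = 0"
  shows "0 < hess x h \<bullet> h"
proof (rule ccontr)
  assume "\<not> 0 < hess x h \<bullet> h"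
  then have le: "hess x h \<bullet> h \<le> 0"
    by simp
  define s t r where "s = norm (P x)" and "t = norm (Q x)" and "r = norm (R x)"
  obtain u g1 where u: "0 \<le> g1" "(norm (P h))\<^sup>2 = u\<^sup>2 + g1" "P x \<bullet> h = s * u"
    using norm_square_decomposition[of "P h" "P x"] unfolding s_def inner_left[of x h] by blast
  obtain v g2 where v: "0 \<le> g2" "(norm (Q h))\<^sup>2 = v\<^sup>2 + g2" "Q x \<bullet> h = t * v"
    using norm_square_decomposition[of "Q h" "Q x"] unfolding t_def inner_left[of x h] by blast
  obtain w g3 where w: "0 \<le> g3" "(norm (R h))\<^sup>2 = w\<^sup>2 + g3" "R x \<bullet> h = r * w"
    using norm_square_decomposition[of "R h" "R x"] unfolding r_def inner_left[of x h] by blast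
  have pos: "0 < mu x" "0 < kP x" "0 < kQ x"
    using x by (auto intro: mu_pos kP_pos kQ_pos)
  have ab: "alpha x = (mu x)\<^sup>2 - s\<^sup>2" "beta x = (mu x)\<^sup>2 - t\<^sup>2" "alpha x * beta x = r\<^sup>2 * (mu x)\<^sup>2"
    "delta x = alpha x + beta x - r\<^sup>2"
    using alpha_beta[of x] delta_eq[of x] norm_split[of x]
    by (simp_all add: alpha_def beta_def s_def t_def r_def)
  have nn: "P h \<bullet> h = (norm (P h))\<^sup>2" "Q h \<bullet> h = (norm (Q h))\<^sup>2" "R h \<bullet> h = (norm (R h))\<^sup>2"
    unfolding power2_norm_eq_inner by (rule inner_left)+
  define F where "F = kP x * u\<^sup>2 + kQ x * v\<^sup>2 + 1 / mu x * w\<^sup>2 - 4 * (s * u) * (t * v) / (3 * mu x ^ 3)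
      - (beta x * (s * u) + alpha x * (t * v) + (mu x)\<^sup>2 * (r * w))\<^sup>2 / (mu x ^ 5 * delta x)"
  have "hess x h \<bullet> h = kP x * (norm (P h))\<^sup>2 + kQ x * (norm (Q h))\<^sup>2 + 1 / mu x * (norm (R h))\<^sup>2
      + dkP x h * (P x \<bullet> h) + dkQ x h * (Q x \<bullet> h) + dkR x h * (R x \<bullet> h)"
    unfolding hess_def nn[symmetric] by (simp add: inner_add_left)
  also have "dkP x h * (P x \<bullet> h) = - beta x * (P x \<bullet> h) * mu_slope x h / (mu x ^ 5 * delta x)
      - 2 * (P x \<bullet> h) * (Q x \<bullet> h) / (3 * mu x ^ 3)"
    unfolding dkP_def by (simp add: algebra_simps)
  also have "dkQ x h * (Q x \<bullet> h) = - alpha x * (Q x \<bullet> h) * mu_slope x h / (mu x ^ 5 * delta x)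
      - 2 * (P x \<bullet> h) * (Q x \<bullet> h) / (3 * mu x ^ 3)"
    unfolding dkQ_def by (simp add: algebra_simps)
  also have "dkR x h * (R x \<bullet> h) = - (mu x)\<^sup>2 * (R x \<bullet> h) * mu_slope x h / (mu x ^ 5 * delta x)"
    using pos by (simp add: dkR_def power_numeral_reduce ac_simps)
  finally have hess_eq: "hess x h \<bullet> h = kP x * g1 + kQ x * g2 + 1 / mu x * g3
      + F"
    unfolding F_def mu_slope_def u(2,3) v(2,3) w(2,3)
    by (simp add: algebra_simps power2_eq_square add_divide_distrib diff_divide_distrib)
  have gs: "0 \<le> kP x * g1" "0 \<le> kQ x * g2" "0 \<le> 1 / mu x * g3"
    using pos u(1) v(1) w(1) by simp_all
  have "F \<ge> 0 \<and> (F = 0 \<longrightarrow> u * t = v * s \<and> u * r = w * s \<and> v * r = w * t)"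
  proof (cases "delta x = 0")
    case True
    have "r = 0" "s\<^sup>2 = (mu x)\<^sup>2" "t\<^sup>2 = (mu x)\<^sup>2"
      using delta_zero[OF True x] ab by (simp_all add: r_def)
    then have rst: "r = 0" "s = mu x" "t = mu x"
      using pos by (simp_all add: s_def t_def)
    \<comment> \<open>Here the square divided by \<open>mu x ^ 5 * delta x\<close> in
      \<open>F\<close> is \<open>0\<close> by the division convention, and
      \<open>s = t = mu x\<close> with \<open>r = 0\<close> leaves two squares.\<close>
    define e1 e2 where "e1 = 2 / (3 * mu x) * (u - v)\<^sup>2" and "e2 = 1 / mu x * w\<^sup>2"
    have form: "F = e1 + e2"
      unfolding F_def e1_def e2_def kP_def kQ_def s_def[symmetric] t_def[symmetric] rst True using pos
      by (simp add: field_simps power_numeral_reduce)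
    have e: "0 \<le> e1" "0 \<le> e2"
      unfolding e1_def e2_def using pos by simp_all
    have "u = v \<and> w = 0" if "F = 0"
    proof -
      have "e1 = 0" "e2 = 0"
        using e that unfolding form by linarith+
      then show ?thesis
        using pos unfolding e1_def e2_def by simp
    qed
    then show ?thesis
      using e form rst by simp
  next
    case False
    then have d: "0 < delta x"
      using delta_nonneg[of x] by simp
    define e1 e2 e3 where "e1 = (2 / (3 * mu x ^ 3) + alpha x * beta x / (mu x ^ 5 * delta x)) * (u * t - v * s)\<^sup>2"
      and "e2 = beta x / (mu x ^ 3 * delta x) * (u * r - w * s)\<^sup>2"
      and "e3 = alpha x / (mu x ^ 3 * delta x) * (v * r - w * t)\<^sup>2"
    have form: "F = e1 + e2 + e3"
      unfolding F_def kP_def kQ_def s_def[symmetric] t_def[symmetric] e1_def e2_def e3_def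
      using pos(1) d ab by (rule confocal_form_sum_of_squares)
    have c1: "0 < 2 / (3 * mu x ^ 3) + alpha x * beta x / (mu x ^ 5 * delta x)"
      using pos d alpha_nonneg[of x] beta_nonneg[of x] by (intro add_pos_nonneg) auto
    have e: "0 \<le> e1" "0 \<le> e2" "0 \<le> e3"
      unfolding e1_def e2_def e3_def
      using pos d c1 alpha_nonneg[of x] beta_nonneg[of x] by simp_all
    have "u * t = v * s \<and> u * r = w * s \<and> v * r = w * t" if "F = 0"
    proof -
      have z: "e1 = 0" "e2 = 0" "e3 = 0"
        using e that unfolding form by linarith+
      have ut: "u * t = v * s"
        using z(1) c1 unfolding e1_def by simp
      have ur: "beta x = 0 \<or> u * r = w * s" and vr: "alpha x = 0 \<or> v * r = w * t"
        using z(2,3) pos d unfolding e2_def e3_def by auto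
      \<comment> \<open>A weight may vanish. If \<open>beta x = 0\<close>, then
        \<open>r = 0\<close>, while \<open>t\<close> and \<open>alpha x\<close> are nonzero; so
        \<open>v * r = w * t\<close> forces \<open>w = 0\<close>, and the missing relation becomes
        trivial. The case \<open>alpha x = 0\<close> is symmetric.\<close>
      consider "beta x = 0" | "alpha x = 0" | "u * r = w * s" "v * r = w * t"
        using ur vr by blast
      then show ?thesis
      proof cases
        case 1
        then have "r = 0" "alpha x \<noteq> 0" "t \<noteq> 0"
          using ab pos d by auto
        then show ?thesis
          using ut vr by simp
      next
        case 2
        then have "r = 0" "beta x \<noteq> 0" "s \<noteq> 0"
          using ab pos d by auto
        then show ?thesis
          using ut ur by simp
      next
        case 3
        then show ?thesis
          using ut by simp
      qed
    qed
    then show ?thesis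
      using e form by simp
  qed
  then have Fs: "F \<ge> 0" "F = 0 \<Longrightarrow> u * t = v * s \<and> u * r = w * s \<and> v * r = w * t"
    by blast+
  have "kP x * g1 = 0" "kQ x * g2 = 0" "1 / mu x * g3 = 0" and form0: "F = 0"
    using le gs Fs(1) unfolding hess_eq by linarith+
  then have g: "g1 = 0" "g2 = 0" "g3 = 0"
    using pos by simp_all
  have par: "u * t = v * s" "u * r = w * s" "v * r = w * t"
    using Fs(2)[OF form0] by blast+
  \<comment> \<open>\<open>N\<close> equals \<open>grad x \<bullet> x\<close>. By parallelism,
    \<open>u N\<close>, \<open>v N\<close> and \<open>w N\<close> are multiples of
    \<open>grad x \<bullet> h = 0\<close>, so the radial components of \<open>h\<close> vanish
    too.\<close>
  define N where "N = kP x * s\<^sup>2 + kQ x * t\<^sup>2 + 1 / mu x * r\<^sup>2"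
  have "0 < N"
  proof -
    have "s \<noteq> 0 \<or> t \<noteq> 0 \<or> r \<noteq> 0"
      using norm_split[of x] x unfolding s_def t_def r_def by auto
    moreover have "0 \<le> kP x * s\<^sup>2" "0 \<le> kQ x * t\<^sup>2" "0 \<le> 1 / mu x * r\<^sup>2"
      using pos by simp_all
    moreover have "0 < kP x * s\<^sup>2" if "s \<noteq> 0" using that pos by simp
    moreover have "0 < kQ x * t\<^sup>2" if "t \<noteq> 0" using that pos by simp
    moreover have "0 < 1 / mu x * r\<^sup>2" if "r \<noteq> 0" using that pos by simp
    ultimately show ?thesis
      unfolding N_def by linarith
  qed
  have perp': "kP x * (s * u) + kQ x * (t * v) + 1 / mu x * (r * w) = 0"
    using perp unfolding grad_def inner_add_left inner_scaleR_left u(3) v(3) w(3) .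
  have "u * N = s * (kP x * (s * u) + kQ x * (t * v) + 1 / mu x * (r * w))"
    "v * N = t * (kP x * (s * u) + kQ x * (t * v) + 1 / mu x * (r * w))"
    "w * N = r * (kP x * (s * u) + kQ x * (t * v) + 1 / mu x * (r * w))"
    unfolding N_def using par by algebra+
  then have "u = 0" "v = 0" "w = 0"
    using \<open>0 < N\<close> unfolding perp' by simp_all
  then have "(norm h)\<^sup>2 = 0"
    unfolding norm_split[of h] u(2) v(2) w(2) using g by simp
  then show False
    using h by simp
qed

end

section \<open>Gradients, partial derivatives and the differential of \<open>sgn\<close>\<close>

lemma gradient_eq:
  fixes f :: "'a::euclidean_space \<Rightarrow> real"
  assumes "(f has_derivative (\<lambda>h. g \<bullet> h)) (at x)"
  shows "gradient f x = g"
  unfolding gradient_def pderiv_dir_def frechet_derivative_at[OF assms, symmetric]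
  by (rule euclidean_representation)

lemma pderiv_dir_eq:
  assumes "(f has_derivative f') (at x)"
  shows "pderiv_dir b f x = f' b"
  unfolding pderiv_dir_def frechet_derivative_at[OF assms, symmetric] ..

lemma sgn_has_derivative:
  fixes x :: "'a::real_inner"
  assumes "x \<noteq> 0"
  shows "(sgn has_derivative (\<lambda>h. (h - (sgn x \<bullet> h) *\<^sub>R sgn x) /\<^sub>R norm x)) (at x)"
proof -
  have "((\<lambda>y. inverse (norm y) *\<^sub>R y) has_derivative
      (\<lambda>h. inverse (norm x) *\<^sub>R h + (- (inverse (norm x) * (sgn x \<bullet> h) * inverse (norm x))) *\<^sub>R x)) (at x)"
    using assms
    by (intro has_derivative_scaleR Deriv.has_derivative_inverse has_derivative_ident)
      (auto intro!: has_derivative_eq_rhs[OF has_derivative_norm] simp: fun_eq_iff inner_commute)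
  moreover have "sgn = (\<lambda>y::'a. inverse (norm y) *\<^sub>R y)"
    by (simp add: fun_eq_iff sgn_div_norm)
  ultimately show ?thesis
    by (simp add: sgn_div_norm algebra_simps)
qed

context orthogonal_splitting
begin

section \<open>Regularity of \<open>Phi\<close> on the sphere\<close>

lemma pderiv_dir_Phi: "x \<noteq> 0 \<Longrightarrow> pderiv_dir b Phi x = grad x \<bullet> b"
  by (rule pderiv_dir_eq[OF Phi_has_derivative])

lemma gradient_Phi: "x \<noteq> 0 \<Longrightarrow> gradient Phi x = grad x"
  by (rule gradient_eq[OF Phi_has_derivative])

lemma pderiv_dir_Phi_has_derivative:
  assumes "x \<noteq> 0"
  shows "(pderiv_dir b Phi has_derivative (\<lambda>h. hess x h \<bullet> b)) (at x)"
proof (rule has_derivative_transform_within_open[where s = "- {0}"])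
  show "((\<lambda>y. grad y \<bullet> b) has_derivative (\<lambda>h. hess x h \<bullet> b)) (at x)"
    by (intro has_derivative_inner_left grad_has_derivative assms)
qed (use assms in \<open>auto simp: pderiv_dir_Phi\<close>)

lemma pderiv_dir_pderiv_dir_Phi: "x \<noteq> 0 \<Longrightarrow> pderiv_dir c (pderiv_dir b Phi) x = hess x c \<bullet> b"
  by (rule pderiv_dir_eq[OF pderiv_dir_Phi_has_derivative])

lemma Phi_C2_holder_sphere: "C2_holder_sphere 1 Phi"
proof -
  \<comment> \<open>An open annulus: boundedness makes products of Lipschitz functions Lipschitz,
    and the distance from the origin keeps \<open>1 / mu\<close> under control.\<close>
  define U :: "'a set" where "U = ball 0 2 \<inter> - cball 0 (1 / 2)"
  have U: "open U" "sphere 0 1 \<subseteq> U" "bounded U" "\<And>x. x \<in> U \<Longrightarrow> x \<noteq> 0" "\<And>x. x \<in> U \<Longrightarrow> 1 / 2 \<le> norm x"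
    by (auto simp: U_def open_Compl intro: bounded_subset[OF bounded_ball, of _ 0 2])
  have lip: "is_lipschitz_on U (pderiv_dir c (pderiv_dir b Phi))" for b c
  proof -
    have "is_lipschitz_on U (\<lambda>x. hess x c \<bullet> b)"
      using U(3) _ U(5) by (rule hess_lipschitz) simp
    then show ?thesis
      using is_lipschitz_on_cong[of U "pderiv_dir c (pderiv_dir b Phi)" "\<lambda>x. hess x c \<bullet> b"]
        pderiv_dir_pderiv_dir_Phi U(4) by blast
  qed
  have "Ck_on 2 U Phi"
    unfolding numeral_2_eq_2 Ck_on.simps
    using lip[THEN is_lipschitz_on_continuous_on] Phi_has_derivative[OF U(4)]
      pderiv_dir_Phi_has_derivative[OF U(4)] unfolding differentiable_def by blast
  then have "C2_holder_on 1 U Phi"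
    unfolding C2_holder_on_def using lip[THEN is_lipschitz_on_imp_holder_on] by blast
  then show ?thesis
    unfolding C2_holder_sphere_def using U(1,2) by blast
qed

section \<open>Homogeneity, evenness and size of \<open>Phi\<close>\<close>

lemma mu_scale:
  assumes "0 \<le> c"
  shows "mu (c *\<^sub>R x) = c * mu x"
proof -
  have "norm (R (c *\<^sub>R x), norm (P (c *\<^sub>R x)) + norm (Q (c *\<^sub>R x)))
      = norm (c *\<^sub>R (R x, norm (P x) + norm (Q x)))"
    "norm (R (c *\<^sub>R x), norm (P (c *\<^sub>R x)) - norm (Q (c *\<^sub>R x)))
      = norm (c *\<^sub>R (R x, norm (P x) - norm (Q x)))"
    using assms by (simp_all add: linear_scale[OF linear(1)] linear_scale[OF linear(2)]
        linear_scale[OF linear(3)] algebra_simps)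
  then show ?thesis
    unfolding mu_def norm_scaleR using assms by (simp add: algebra_simps)
qed

lemma Phi_scale:
  assumes "0 < c"
  shows "Phi (c *\<^sub>R x) = c * Phi x"
  using assms unfolding Phi_def
  by (simp add: mu_scale linear_scale[OF linear(1)] linear_scale[OF linear(2)] power_mult_distrib
      distrib_left power_numeral_reduce)

lemma Phi_minus: "Phi (- x) = Phi x"
  unfolding Phi_def mu_def
  by (simp add: norm_Pair linear_neg[OF linear(1)] linear_neg[OF linear(2)] linear_neg[OF linear(3)])

lemma hom_ext_Phi: "hom_ext Phi = Phi"
proof
  fix x
  show "hom_ext Phi x = Phi x"
  proof (cases "x = 0")
    case True
    then show ?thesis
      using linear_0[OF linear(1)] linear_0[OF linear(2)] linear_0[OF linear(3)]
      by (simp add: hom_ext_def Phi_def mu_def flip: zero_prod_def)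
  next
    case False
    then show ?thesis
      using Phi_scale[of "norm x" "sgn x"] by (simp add: hom_ext_def sgn_div_norm)
  qed
qed

lemma mu_le_Phi: "mu x \<le> Phi x"
  using mu_nonneg[of x] by (simp add: Phi_def)

text \<open>The second summand of \<open>Phi\<close> is at most \<open>mu x\<close>, since
  \<open>mu x\<close> dominates both norms. With \<open>mu_le_Phi\<close> and
  \<open>norm_le_mu\<close> this confines the level set \<open>Phi x = 1\<close> to an
  annulus.\<close>

lemma Phi_le_norm: "Phi x \<le> 2 * norm x"
proof (cases "x = 0")
  case True
  then show ?thesis
    using linear_0[OF linear(1)] linear_0[OF linear(2)] linear_0[OF linear(3)]
    by (simp add: Phi_def mu_def flip: zero_prod_def)
next
  case False
  then have pos: "0 < mu x"
    by (rule mu_pos)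
  have "(norm (P x))\<^sup>2 * (norm (Q x))\<^sup>2 \<le> (mu x)\<^sup>2 * (mu x)\<^sup>2"
    using alpha_nonneg[of x] beta_nonneg[of x] unfolding alpha_def beta_def
    by (intro mult_mono) auto
  also have "\<dots> \<le> mu x * (3 * mu x ^ 3)"
    using pos by (simp add: power_numeral_reduce)
  finally have "(norm (P x))\<^sup>2 * (norm (Q x))\<^sup>2 / (3 * mu x ^ 3) \<le> mu x"
    using pos by (simp add: pos_divide_le_eq)
  then show ?thesis
    using mu_le_norm[of x] by (simp add: Phi_def)
qed

lemma integrand_Phi: "integrand Phi"
  unfolding integrand_def
proof (intro conjI ballI exI)
  fix x :: 'a assume "x \<in> sphere 0 1"
  then have "x \<noteq> 0" by auto
  then show "0 < Phi x"
    using mu_pos mu_le_Phi[of x] by fastforce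
  show "Phi (- x) = Phi x"
    by (rule Phi_minus)
next
  show "C2_holder_sphere 1 Phi"
    by (rule Phi_C2_holder_sphere)
qed simp_all

section \<open>Principal curvatures and uniform ellipticity\<close>

lemma grad_nonzero:
  assumes "x \<noteq> 0"
  shows "grad x \<noteq> 0"
proof
  assume "grad x = 0"
  then have 0: "grad x \<bullet> x = 0"
    by simp
  have "grad x \<bullet> x = kP x * (norm (P x))\<^sup>2 + kQ x * (norm (Q x))\<^sup>2 + 1 / mu x * (norm (R x))\<^sup>2"
    unfolding grad_def inner_add_left inner_scaleR_left inner_left[of x x] power2_norm_eq_inner ..
  moreover have "0 \<le> kP x * (norm (P x))\<^sup>2" "0 \<le> kQ x * (norm (Q x))\<^sup>2" "0 \<le> 1 / mu x * (norm (R x))\<^sup>2"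
    using kP_pos kQ_pos mu_pos assms by (simp_all add: less_imp_le)
  ultimately have "kP x * (norm (P x))\<^sup>2 = 0" "kQ x * (norm (Q x))\<^sup>2 = 0" "1 / mu x * (norm (R x))\<^sup>2 = 0"
    using 0 by linarith+
  then have "P x = 0" "Q x = 0" "R x = 0"
    using kP_pos[OF assms] kQ_pos[OF assms] mu_pos[OF assms] by simp_all
  then show False
    using split[of x] assms by simp
qed

text \<open>The differential of the Gauss map is the Hessian, projected to the tangent space and
  divided by the length of the gradient. Pairing the eigenvalue equation with a unit tangent
  eigenvector removes the projection.\<close>

lemma principal_curvature_Phi:
  assumes x: "x \<noteq> 0" and "principal_curvature Phi x \<kappa>"
  obtains \<xi> where "norm \<xi> = 1" "grad x \<bullet> \<xi> = 0" "\<kappa> = hess x \<xi> \<bullet> \<xi> / norm (grad x)"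
proof -
  obtain \<eta> where \<eta>: "\<eta> \<noteq> 0" "\<eta> \<bullet> grad x = 0"
    "frechet_derivative (\<lambda>y. sgn (gradient Phi y)) (at x) \<eta> = \<kappa> *\<^sub>R \<eta>"
    using assms(2) unfolding principal_curvature_def gradient_Phi[OF x] by blast
  let ?d = "\<lambda>h. (hess x h - (sgn (grad x) \<bullet> hess x h) *\<^sub>R sgn (grad x)) /\<^sub>R norm (grad x)"
  have "((\<lambda>y. sgn (grad y)) has_derivative ?d) (at x)"
    using has_derivative_compose[OF grad_has_derivative[OF x] sgn_has_derivative[OF grad_nonzero[OF x]]] .
  then have D: "((\<lambda>y. sgn (gradient Phi y)) has_derivative ?d) (at x)"
    by (rule has_derivative_transform_within_open[where s = "- {0}"]) (use x in \<open>auto simp: gradient_Phi\<close>)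
  have eq: "?d \<eta> = \<kappa> *\<^sub>R \<eta>"
    using \<eta>(3) unfolding frechet_derivative_at[OF D, symmetric] .
  define \<xi> where "\<xi> = sgn \<eta>"
  have \<xi>: "norm \<xi> = 1" "grad x \<bullet> \<xi> = 0" "\<eta> = norm \<eta> *\<^sub>R \<xi>"
    using \<eta>(1,2) by (simp_all add: \<xi>_def norm_sgn sgn_div_norm inner_commute)
  have "linear (hess x)"
    using grad_has_derivative[OF x] by (rule has_derivative_linear)
  then have "norm \<eta> *\<^sub>R ?d \<xi> = ?d (norm \<eta> *\<^sub>R \<xi>)"
    by (simp add: linear_scale scaleR_diff_right mult.commute mult.left_commute)
  also have "\<dots> = \<kappa> *\<^sub>R (norm \<eta> *\<^sub>R \<xi>)"
    unfolding \<xi>(3)[symmetric] by (rule eq)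
  also have "\<dots> = norm \<eta> *\<^sub>R (\<kappa> *\<^sub>R \<xi>)"
    by (rule scaleR_left_commute)
  finally have "?d \<xi> = \<kappa> *\<^sub>R \<xi>"
    using \<eta>(1) by (simp only: scaleR_cancel_left norm_eq_zero simp_thms)
  then have "?d \<xi> \<bullet> \<xi> = \<kappa> * (\<xi> \<bullet> \<xi>)"
    by simp
  moreover have "sgn (grad x) \<bullet> \<xi> = 0"
    using \<xi>(2) by (simp add: sgn_div_norm)
  ultimately have "\<kappa> = hess x \<xi> \<bullet> \<xi> / norm (grad x)"
    using \<xi>(1) by (simp add: inner_diff_left divide_inverse mult.commute power2_norm_eq_inner[symmetric])
  with \<xi>(1,2) show thesis
    by (rule that)
qed

lemma continuous_on_grad: "continuous_on (- {0}) grad"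
  using grad_has_derivative has_derivative_continuous
  by (intro continuous_at_imp_continuous_on) blast

text \<open>Compactness: \<open>f\<close>, the normalized Hessian form, is continuous and positive
  on the compact set \<open>K\<close> of pairs of a point in an annulus and a unit tangent vector,
  so its minimum bounds all principal curvatures from below.\<close>

lemma uniformly_elliptic_Phi: "uniformly_elliptic Phi"
proof -
  define A :: "'a set" where "A = cball 0 2 - ball 0 (1 / 2)"
  have A: "compact A" "\<And>x. x \<in> A \<Longrightarrow> x \<noteq> 0" "bounded A" "\<And>x. x \<in> A \<Longrightarrow> 1 / 2 \<le> norm x"
    by (auto simp: A_def intro: compact_diff bounded_subset[OF bounded_cball, of _ 0 2])
  define K where "K = {(x, \<xi>). (x, \<xi>) \<in> A \<times> sphere 0 1 \<and> grad x \<bullet> \<xi> = 0}"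
  define f where "f p = hess (fst p) (snd p) \<bullet> snd p / norm (grad (fst p))" for p
  have AS: "compact (A \<times> sphere (0::'a) 1)"
    using A(1) by (intro compact_Times) simp_all
  have grad: "continuous_on (A \<times> sphere 0 1) (\<lambda>p. grad (fst p))"
    by (rule continuous_on_compose2[OF continuous_on_grad]) (use A(2) in \<open>auto intro: continuous_intros\<close>)
  \<comment> \<open>\<open>hess_lipschitz\<close> gives continuity in \<open>x\<close> for fixed
    directions only; expansion in the basis yields joint continuity.\<close>
  have hess_eq: "hess x \<xi> \<bullet> \<xi> = (\<Sum>b\<in>Basis. \<Sum>c\<in>Basis. (\<xi> \<bullet> b) * (\<xi> \<bullet> c) * (hess x b \<bullet> c))"
    if "x \<in> A" for x \<xi>
  proof -
    have lin: "linear (hess x)"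
      using grad_has_derivative[OF A(2)[OF that]] by (rule has_derivative_linear)
    have "hess x \<xi> = hess x (\<Sum>b\<in>Basis. (\<xi> \<bullet> b) *\<^sub>R b)"
      by (simp add: euclidean_representation)
    also have "\<dots> = (\<Sum>b\<in>Basis. (\<xi> \<bullet> b) *\<^sub>R hess x b)"
      using lin by (simp add: linear_sum linear_scale)
    finally have "hess x \<xi> \<bullet> \<xi> = (\<Sum>b\<in>Basis. (\<xi> \<bullet> b) * (hess x b \<bullet> \<xi>))"
      by (simp add: inner_sum_left)
    also have "\<dots> = (\<Sum>b\<in>Basis. (\<xi> \<bullet> b) * (\<Sum>c\<in>Basis. (hess x b \<bullet> c) * (\<xi> \<bullet> c)))"
      by (subst euclidean_inner) simp
    finally show ?thesis
      by (simp add: sum_distrib_left ac_simps)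
  qed
  have hess: "continuous_on (A \<times> sphere 0 1) (\<lambda>p. hess (fst p) (snd p) \<bullet> snd p)"
  proof (rule continuous_on_eq)
    have h: "continuous_on (A \<times> sphere 0 1) (\<lambda>p. hess (fst p) b \<bullet> c)" for b c
      by (rule continuous_on_compose2[OF is_lipschitz_on_continuous_on[OF
              hess_lipschitz[OF A(3) _ A(4), of b c]]]) (auto intro: continuous_intros)
    show "continuous_on (A \<times> sphere 0 1)
        (\<lambda>p. \<Sum>b\<in>Basis. \<Sum>c\<in>Basis. (snd p \<bullet> b) * (snd p \<bullet> c) * (hess (fst p) b \<bullet> c))"
      by (rule h | rule continuous_intros)+
  qed (auto simp: hess_eq)
  have "compact K"
  proof -
    have "continuous_on (A \<times> sphere 0 1) (\<lambda>p. grad (fst p) \<bullet> snd p)"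
      using grad by (intro continuous_intros)
    from continuous_closed_preimage[OF this compact_imp_closed[OF AS], of "{0}"]
    have "closed K"
      by (rule back_subst[of closed]) (auto simp: K_def)
    then have "compact ((A \<times> sphere 0 1) \<inter> K)"
      using AS by (rule compact_Int_closed[rotated])
    moreover have "(A \<times> sphere 0 1) \<inter> K = K"
      by (auto simp: K_def)
    ultimately show ?thesis
      by simp
  qed
  moreover have "continuous_on K f"
  proof -
    have sub: "K \<subseteq> A \<times> sphere 0 1"
      by (auto simp: K_def)
    show ?thesis
      unfolding f_def[abs_def]
      using A(2) grad_nonzero
      by (intro continuous_on_divide continuous_on_norm continuous_on_subset[OF hess sub]
          continuous_on_subset[OF grad sub]) (auto simp: K_def)
  qed
  moreover have f_pos: "0 < f p" if "p \<in> K" for p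
    unfolding f_def
  proof (rule divide_pos_pos)
    have p: "fst p \<noteq> 0" "snd p \<noteq> 0" "grad (fst p) \<bullet> snd p = 0"
      using that A(2) by (auto simp: K_def)
    show "0 < hess (fst p) (snd p) \<bullet> snd p"
      using p by (rule hess_positive)
    show "0 < norm (grad (fst p))"
      using grad_nonzero[OF p(1)] by simp
  qed
  ultimately obtain c where c: "0 < c" "\<And>p. p \<in> K \<Longrightarrow> c \<le> f p"
  proof (cases "K = {}")
    case False
    from continuous_attains_inf[OF \<open>compact K\<close> this \<open>continuous_on K f\<close>]
    show thesis
      using f_pos that by blast
  \<comment> \<open>Without tangent pairs the lower bound is vacuous and any positive constant
    serves.\<close>
  qed (use that[of 1] in simp)
  have "c \<le> \<kappa>" if "Phi x = 1" and curv: "principal_curvature Phi x \<kappa>" for x \<kappa>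
  proof -
    have "1 \<le> 2 * norm x" "norm x \<le> 2"
      using Phi_le_norm[of x] mu_le_Phi[of x] norm_le_mu[of x] that(1) by simp_all
    then have x: "x \<in> A"
      by (simp add: A_def)
    obtain \<xi> where \<xi>: "norm \<xi> = 1" "grad x \<bullet> \<xi> = 0" "\<kappa> = hess x \<xi> \<bullet> \<xi> / norm (grad x)"
      using principal_curvature_Phi[OF A(2)[OF x] curv] .
    then have "(x, \<xi>) \<in> K"
      using x by (simp add: K_def)
    from c(2)[OF this] show ?thesis
      by (simp add: f_def \<xi>(3))
  qed
  then show ?thesis
    unfolding uniformly_elliptic_def hom_ext_Phi using c(1) by blast
qed

end

section \<open>The minimal graph\<close>

context orthogonal_splitting
begin

lemma dkP_linear: "x \<noteq> 0 \<Longrightarrow> linear (dkP x)" and dkQ_linear: "x \<noteq> 0 \<Longrightarrow> linear (dkQ x)"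
  using kP_has_derivative kQ_has_derivative has_derivative_linear by blast+

text \<open>The ultrahyperbolic equation in terms of the coefficients: the trace of the Hessian over
  the \<open>P\<close> block minus that over the \<open>Q\<close> block, each of dimension 3. The
  differences \<open>kP x - kQ x\<close> and \<open>dkP x (P x) - dkQ x (Q x)\<close> are in the
  ratio \<open>1 : -3\<close>, so dimension 3 makes them cancel.\<close>

lemma trace_identity:
  assumes x: "x \<noteq> 0" and d: "0 < delta x"
  shows "3 * kP x - 3 * kQ x + dkP x (P x) - dkQ x (Q x) = 0"
proof -
  define m X Y d where "m = mu x" and "X = alpha x" and "Y = beta x" and "d = delta x"
  have pos: "0 < m" "0 < d"
    using mu_pos[OF x] d by (simp_all add: m_def d_def)
  have ab: "(norm (P x))\<^sup>2 = m\<^sup>2 - X" "(norm (Q x))\<^sup>2 = m\<^sup>2 - Y"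
    by (simp_all add: m_def X_def Y_def alpha_def beta_def)
  have "d = X + Y - (norm (R x))\<^sup>2"
    using delta_eq[of x] norm_split[of x]
    by (simp add: m_def d_def X_def Y_def alpha_def beta_def)
  then have "m\<^sup>2 * d = m\<^sup>2 * (X + Y - (norm (R x))\<^sup>2)"
    by simp
  then have md: "m\<^sup>2 * d = m\<^sup>2 * X + m\<^sup>2 * Y - X * Y"
    using alpha_beta[of x] by (simp add: m_def X_def Y_def algebra_simps)
  have k: "3 * kP x - 3 * kQ x = (Y - X) / m ^ 3"
    unfolding kP_def kQ_def m_def[symmetric] ab using pos by (simp add: field_simps power_numeral_reduce)
  have dP: "dkP x (P x) = - Y\<^sup>2 * (m\<^sup>2 - X) / (m ^ 5 * d)"
    unfolding ab[symmetric] unfolding dkP_def mu_slope_def m_def X_def Y_def d_def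
    by (simp add: orthogonal orthogonal' dot_square_norm power2_eq_square)
  have dQ: "dkQ x (Q x) = - X\<^sup>2 * (m\<^sup>2 - Y) / (m ^ 5 * d)"
    unfolding ab[symmetric] unfolding dkQ_def mu_slope_def m_def X_def Y_def d_def
    by (simp add: orthogonal orthogonal' dot_square_norm power2_eq_square)
  have "(Y - X) * (m\<^sup>2 * d) - Y\<^sup>2 * (m\<^sup>2 - X) + X\<^sup>2 * (m\<^sup>2 - Y) = 0"
    unfolding md by (simp add: algebra_simps power2_eq_square)
  moreover have "(Y - X) / m ^ 3 = (Y - X) * (m\<^sup>2 * d) / (m ^ 5 * d)"
    using pos by (simp add: power_numeral_reduce)
  ultimately show ?thesis
    unfolding k dP dQ by (simp add: algebra_simps flip: add_divide_distrib diff_divide_distrib)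
qed

end

section \<open>Smoothness of quadratic functions\<close>

lemma Ck_on_const: "Ck_on k U (\<lambda>x. c)"
proof (induction k arbitrary: c)
  case (Suc k)
  have "pderiv_dir b (\<lambda>x. c) = (\<lambda>x. 0)" for b :: 'a
    by (rule ext) (rule pderiv_dir_eq[OF has_derivative_const])
  then show ?case
    using Suc by simp
qed simp

lemma smooth_on_quadratic:
  fixes f :: "'a::euclidean_space \<Rightarrow> real"
  assumes L: "bounded_linear L" and f: "\<And>x. (f has_derivative (\<lambda>h. L x \<bullet> h)) (at x)"
  shows "smooth_on U f"
  unfolding smooth_on_def
proof
  fix k
  have Ld: "((\<lambda>y. L y \<bullet> b) has_derivative (\<lambda>h. L h \<bullet> b)) (at x)" for x b
    by (intro has_derivative_inner_left bounded_linear_imp_has_derivative L)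
  have Lk: "Ck_on k U (\<lambda>y. L y \<bullet> b)" for k b
  proof (cases k)
    case 0
    then show ?thesis
      using linear_continuous_on[OF L] by (auto intro: continuous_intros)
  next
    case (Suc j)
    have "pderiv_dir c (\<lambda>y. L y \<bullet> b) = (\<lambda>x. L c \<bullet> b)" for c
      by (rule ext) (rule pderiv_dir_eq[OF Ld])
    moreover have "(\<lambda>y. L y \<bullet> b) differentiable at x" for x
      using Ld unfolding differentiable_def by blast
    ultimately show ?thesis
      by (simp add: Suc Ck_on_const)
  qed
  have fd: "pderiv_dir b f = (\<lambda>y. L y \<bullet> b)" for b
    by (rule ext) (rule pderiv_dir_eq[OF f])
  show "Ck_on k U f"
  proof (cases k)
    case 0
    then show ?thesis
      using has_derivative_continuous[OF f] by (auto intro: continuous_at_imp_continuous_on)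
  next
    case (Suc j)
    have "f differentiable at x" for x
      using f unfolding differentiable_def by blast
    then show ?thesis
      by (simp add: Suc fd Lk)
  qed
qed

section \<open>Splitting by coordinates and the quadratic polynomial\<close>

definition vec_restrict :: "'n set \<Rightarrow> real^'n \<Rightarrow> real^'n" where
  "vec_restrict I x = (\<chi> i. if i \<in> I then x $ i else 0)"

lemma linear_vec_restrict: "linear (vec_restrict I)"
  by (rule linearI) (auto simp: vec_restrict_def vec_eq_iff)

lemma inner_vec_restrict: "vec_restrict I x \<bullet> y = (\<Sum>i\<in>I. x $ i * y $ i)"
  by (simp add: vec_restrict_def inner_vec_def if_distrib[of "\<lambda>z. z * _"] sum.If_cases cong: if_cong)

lemma trace_vec_restrict: "(\<Sum>b\<in>Basis. vec_restrict I b \<bullet> b) = real (card (I :: 'n::finite set))"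
proof -
  have "(\<Sum>b\<in>Basis. vec_restrict I b \<bullet> b) = (\<Sum>i\<in>UNIV. vec_restrict I (axis i 1) \<bullet> axis i 1)"
    by (simp add: Basis_vec_def UNION_singleton_eq_range sum.reindex inj_on_def axis_eq_axis)
  also have "\<dots> = (\<Sum>i\<in>UNIV. if i \<in> I then 1 else 0)"
    by (rule sum.cong) (simp_all add: inner_axis vec_restrict_def)
  finally show ?thesis
    by (simp add: sum.If_cases)
qed

definition prod_restrict :: "'n set \<Rightarrow> (real^'n) \<times> real \<Rightarrow> (real^'n) \<times> real" where
  "prod_restrict I x = (vec_restrict I (fst x), 0)"

definition vertical :: "'a::real_vector \<times> real \<Rightarrow> 'a \<times> real" where
  "vertical x = (0, snd x)"

lemma orthogonal_splitting_restrict: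
  "orthogonal_splitting (prod_restrict I) (prod_restrict (- I)) (vertical :: (real^'n) \<times> real \<Rightarrow> _)"
proof (rule orthogonal_splitting.intro)
  have "linear (prod_restrict I)" for I :: "'n set"
    by (rule linearI) (simp_all add: prod_restrict_def linear_add[OF linear_vec_restrict] linear_scale[OF linear_vec_restrict])
  then show "linear (prod_restrict I)" "linear (prod_restrict (- I))"
    by this+
  show "linear (vertical :: (real^'n) \<times> real \<Rightarrow> _)"
    by (rule linearI) (simp_all add: vertical_def)
  show "prod_restrict I x + prod_restrict (- I) x + vertical x = x" for x
    by (simp add: prod_restrict_def vertical_def vec_restrict_def prod_eq_iff vec_eq_iff)
  show "prod_restrict I x \<bullet> prod_restrict (- I) y = 0" for x y
    by (simp add: prod_restrict_def inner_vec_restrict) (simp add: vec_restrict_def)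
qed (simp_all add: prod_restrict_def vertical_def)

text \<open>This map is both the gradient and the constant Hessian of the polynomial
  \<open>(reflect I x \<bullet> x) / 2\<close>.\<close>

definition reflect :: "'n set \<Rightarrow> real^'n \<Rightarrow> real^'n" where
  "reflect I x = vec_restrict I x - vec_restrict (- I) x"

lemma linear_reflect: "linear (reflect I)"
  unfolding reflect_def[abs_def] by (intro linear_compose_sub linear_vec_restrict)

lemma restrict_reflect:
  "vec_restrict I (reflect I x) = vec_restrict I x" "vec_restrict (- I) (reflect I x) = - vec_restrict (- I) x"
  "reflect I (vec_restrict I x) = vec_restrict I x" "reflect I (vec_restrict (- I) x) = - vec_restrict (- I) x"
  by (auto simp: reflect_def vec_restrict_def vec_eq_iff)

lemma half_reflect_has_derivative:
  fixes I :: "'n::finite set"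
  shows "((\<lambda>x. (reflect I x \<bullet> x) / 2) has_derivative (\<lambda>h. reflect I x \<bullet> h)) (at x)"
proof -
  have L: "(reflect I has_derivative reflect I) (at x)"
    using linear_reflect[of I] unfolding linear_conv_bounded_linear
    by (rule bounded_linear_imp_has_derivative)
  have sym: "reflect I h \<bullet> x = reflect I x \<bullet> h" for h
    unfolding reflect_def inner_diff_left inner_vec_restrict by (simp add: mult.commute)
  show ?thesis
    by (rule has_derivative_eq_rhs[OF bounded_linear.has_derivative[OF bounded_linear_divide
          has_derivative_inner[OF L has_derivative_ident]]])
      (simp add: fun_eq_iff sym inner_commute[of x])
qed

lemma quadratic_polynomial_half_reflect:
  "quadratic_polynomial (\<lambda>x :: real^'n. (reflect I x \<bullet> x) / 2)"
  unfolding quadratic_polynomial_def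
proof (intro exI conjI allI)
  let ?A = "(\<chi> i j. if i = j then (if i \<in> I then 1 / 2 else - 1 / 2) else 0) :: real^'n^'n"
  show "transpose ?A = ?A"
    by (auto simp: transpose_def vec_eq_iff)
  have "?A $ i $ i \<noteq> 0" for i
    by simp
  then show "?A \<noteq> 0"
    by (metis zero_index)
  show "(reflect I x \<bullet> x) / 2 = x \<bullet> (?A *v x) + 0 \<bullet> x + 0" for x :: "real^'n"
  proof -
    have "?A *v x = (1 / 2) *\<^sub>R reflect I x"
      by (auto simp: matrix_vector_mult_def reflect_def vec_restrict_def vec_eq_iff if_distrib[of "\<lambda>z. z * _"] cong: if_cong)
    then show ?thesis
      by (simp add: inner_commute)
  qed
qed

text \<open>As the Hessian of the polynomial is \<open>reflect I\<close>, the divergence is the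
  trace over the coordinates in \<open>I\<close> of the Hessian of \<open>Phi\<close> minus the
  trace over the others, taken at the upward normal. This is the left side of
  \<open>trace_identity\<close>.\<close>

lemma Phi_minimal_half_reflect:
  fixes I :: "'n::finite set"
  assumes I: "card I = 3" "card (- I) = 3"
  shows "Phi_minimal_on (orthogonal_splitting.Phi (prod_restrict I) (prod_restrict (- I)) vertical) UNIV
    (\<lambda>x. (reflect I x \<bullet> x) / 2)"
proof -
  interpret orthogonal_splitting "prod_restrict I" "prod_restrict (- I)"
    "vertical :: (real^'n) \<times> real \<Rightarrow> _"
    by (rule orthogonal_splitting_restrict)
  let ?u = "\<lambda>x. (reflect I x \<bullet> x) / 2"
  let ?J = "\<lambda>v :: real^'n. (- v, 1 :: real)"
  have bl: "bounded_linear (reflect I)"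
    using linear_reflect by (simp add: linear_conv_bounded_linear)
  have J0: "?J v \<noteq> 0" for v
    by (simp add: prod_eq_iff)
  have grad_u: "gradient ?u x = reflect I x" for x
    by (rule gradient_eq[OF half_reflect_has_derivative])
  have grad_phi: "gradient (graph_integrand Phi) v = - fst (grad (?J v))" for v
  proof (rule gradient_eq)
    have "(?J has_derivative (\<lambda>h. (- h, 0))) (at v)"
      by (intro has_derivative_Pair has_derivative_minus has_derivative_ident has_derivative_const)
    from has_derivative_compose[OF this Phi_has_derivative[OF J0]]
    show "(graph_integrand Phi has_derivative (\<lambda>h. - fst (grad (?J v)) \<bullet> h)) (at v)"
      unfolding graph_integrand_def[abs_def] hom_ext_Phi
      by (rule has_derivative_eq_rhs) (simp add: fun_eq_iff inner_prod_def)
  qed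
  have "divergence (\<lambda>y. gradient (graph_integrand Phi) (gradient ?u y)) x = 0" for x
  proof -
    define w where "w = ?J (reflect I x)"
    have w0: "w \<noteq> 0"
      unfolding w_def by (rule J0)
    \<comment> \<open>The vertical component of the upward normal is \<open>1\<close>, so
      \<open>w\<close> stays off the cone where \<open>delta\<close> vanishes.\<close>
    have "delta w \<noteq> 0"
      using delta_zero(3)[OF _ w0] by (auto simp: vertical_def w_def prod_eq_iff)
    then have d: "0 < delta w"
      using delta_nonneg[of w] by simp
    have lin: "linear (hess w)"
      using grad_has_derivative[OF w0] by (rule has_derivative_linear)
    \<comment> \<open>The sign from \<open>graph_integrand\<close> evaluating at \<open>- v\<close>
      occurs once per differentiation, so the two signs cancel.\<close>
    have pd: "pderiv_dir b (\<lambda>y. - fst (grad (?J (reflect I y))) \<bullet> b) x = hess w (reflect I b, 0) \<bullet> (b, 0)" for b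
    proof -
      have "((\<lambda>y. ?J (reflect I y)) has_derivative (\<lambda>h. (- reflect I h, 0))) (at x)"
        by (intro has_derivative_Pair has_derivative_minus has_derivative_const
            bounded_linear_imp_has_derivative bl)
      from has_derivative_compose[OF this grad_has_derivative[OF J0]]
      have "((\<lambda>y. grad (?J (reflect I y))) has_derivative (\<lambda>h. hess w (- reflect I h, 0))) (at x)"
        unfolding w_def .
      then have "((\<lambda>y. - fst (grad (?J (reflect I y))) \<bullet> b) has_derivative
          (\<lambda>h. - fst (hess w (- reflect I h, 0)) \<bullet> b)) (at x)"
        by (intro has_derivative_inner_left has_derivative_minus has_derivative_fst)
      from pderiv_dir_eq[OF this]
      show ?thesis
        using linear_neg[OF lin, of "(reflect I b, 0)"] by (simp add: inner_prod_def)
    qed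
    \<comment> \<open>The trace of a rank-one map composed with the reflection; it evaluates the
      \<open>dkP\<close> and \<open>dkQ\<close> terms of the Hessian. The \<open>dkR\<close> term is
      vertical and does not enter the trace.\<close>
    have rw: "linear T \<Longrightarrow> (\<Sum>b\<in>Basis. T (reflect I b, 0) * (p \<bullet> b)) = T (reflect I p, 0 :: real)"
      for T :: "(real^'n) \<times> real \<Rightarrow> real" and p
    proof -
      assume T: "linear T"
      have "linear (\<lambda>b. (reflect I b, 0 :: real))"
        by (rule linearI) (simp_all add: linear_add[OF linear_reflect] linear_scale[OF linear_reflect])
      from linear_compose[OF this T] have "linear (\<lambda>b. T (reflect I b, 0))"
        by (simp add: o_def)
      then have "T (reflect I (\<Sum>b\<in>Basis. (p \<bullet> b) *\<^sub>R b), 0) = (\<Sum>b\<in>Basis. (p \<bullet> b) *\<^sub>R T (reflect I b, 0))"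
        by (simp add: linear_sum[of "\<lambda>b. T (reflect I b, 0)"] linear_scale[of "\<lambda>b. T (reflect I b, 0)"])
      then show ?thesis
        by (simp add: euclidean_representation mult.commute)
    qed
    have "divergence (\<lambda>y. gradient (graph_integrand Phi) (gradient ?u y)) x
        = (\<Sum>b\<in>Basis. hess w (reflect I b, 0) \<bullet> (b, 0))"
      unfolding divergence_def grad_u grad_phi pd ..
    also have "\<dots> = (\<Sum>b\<in>Basis. kP w * (vec_restrict I b \<bullet> b) - kQ w * (vec_restrict (- I) b \<bullet> b)
        + dkP w (reflect I b, 0) * (vec_restrict I (fst w) \<bullet> b)
        + dkQ w (reflect I b, 0) * (vec_restrict (- I) (fst w) \<bullet> b))"
      unfolding hess_def
      by (simp add: prod_restrict_def vertical_def restrict_reflect inner_add_left algebra_simps)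
    also have "\<dots> = 3 * kP w - 3 * kQ w + dkP w (reflect I (vec_restrict I (fst w)), 0)
        + dkQ w (reflect I (vec_restrict (- I) (fst w)), 0)"
      unfolding sum.distrib sum_subtractf sum_distrib_left[symmetric] trace_vec_restrict I
        rw[OF dkP_linear[OF w0]] rw[OF dkQ_linear[OF w0]] by simp
    also have "\<dots> = 3 * kP w - 3 * kQ w + dkP w (prod_restrict I w) - dkQ w (prod_restrict (- I) w)"
      using linear_neg[OF dkQ_linear[OF w0], of "prod_restrict (- I) w"]
      by (simp add: restrict_reflect prod_restrict_def)
    also have "\<dots> = 0"
      using w0 d by (rule trace_identity)
    finally show ?thesis .
  qed
  then show ?thesis
    unfolding Phi_minimal_on_def using smooth_on_quadratic[OF bl half_reflect_has_derivative] by blast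
qed

theorem theorem1p1:
  "\<exists>(u :: real^6 \<Rightarrow> real) (\<Phi> :: (real^6) \<times> real \<Rightarrow> real).
     quadratic_polynomial u \<and>
     integrand \<Phi> \<and> C2_holder_sphere 1 \<Phi> \<and> uniformly_elliptic \<Phi> \<and>
     Phi_minimal_on \<Phi> UNIV u"
proof -
  define I :: "6 set" where "I = {1, 2, 3}"
  have I: "card I = 3" "card (- I) = 3"
    by (simp_all add: I_def Compl_eq_Diff_UNIV card_Diff_subset)
  interpret orthogonal_splitting "prod_restrict I" "prod_restrict (- I)"
    "vertical :: (real^6) \<times> real \<Rightarrow> _"
    by (rule orthogonal_splitting_restrict)
  show ?thesis
    using quadratic_polynomial_half_reflect[of I] integrand_Phi Phi_C2_holder_sphere
      uniformly_elliptic_Phi Phi_minimal_half_reflect[OF I] by blast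
qed

end
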